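(* Let $\tau>0$ be an integer delay, and let $F:\mathbb{R}^d\to\mathbb{R}$ be a convex $\mu$-smooth quadratic function that is bounded from below, with a minimizer $\mathbf{w}^*$. Let $(\mathbf{w}_k)_{k\ge0}$ be the iterates of stochastic delayed gradient descent (SDGD) on $F$ with delay $\tau$, initial point $\mathbf{w}_0$, step size $\eta$, and independent zero-mean noise vectors $\boldsymbol{\xi}_k$ satisfying $\mathbb{E}[\|\boldsymbol{\xi}_k\|^2]\le\sigma^2$. Assume that the step size satisfies $\eta\in\left(0,\frac{1}{20\mu(\tau+1)}\right]$ and that $k\ge(\tau+1)\ln(2(\tau+1))$. Then the following holds. (1) If $F$ is a $\lambda$-strongly convex, $\mu$-smooth quadratic function, then $\mathbb{E}[F(\mathbf{w}_k)-F(\mathbf{w}^* )]$ is at most $$5\mu\exp(-2\eta\lambda(k+1))\|\mathbf{w}_0-\mathbf{w}^*\|^2+\frac{\eta^2\sigma^2}{2}\left(\mu(\tau+1)\ln(2(\tau+1))+\frac{1+e+\ln\left(\frac{1}{\eta\lambda}\right)}{e\eta}\right).$$ In particular, by tuning $\eta$ appropriately, $$\mathbb{E}[F(\mathbf{w}_k)-F(\mathbf{w}^* )]\le\tilde{\mathcal{O}}\left(\frac{\sigma^2}{\lambda k}+\mu\|\mathbf{w}_0-\mathbf{w}^*\|^2\exp\left(-\frac{\lambda k}{10\mu\tau}\right)\right).$$ (2) If $F$ is a $\mu$-smooth convex quadratic function, then $\mathbb{E}[F(\mathbf{w}_k)-F(\mathbf{w}^* )]$ is at most $$\frac{9\|\mathbf{w}_0-\mathbf{w}^*\|^2}{4e\eta(k+1)}+\eta^2\sigma^2\left(\mu(\tau+1)\ln(2(\tau+1))+\frac{9}{2e\eta}(1+\ln(k+1))\right).$$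 In particular, by tuning $\eta$ appropriately, $$\mathbb{E}[F(\mathbf{w}_k)-F(\mathbf{w}^* )]\le\tilde{\mathcal{O}}\left(\frac{\|\mathbf{w}_0-\mathbf{w}^*\|\sigma}{\sqrt{k}}+\frac{\|\mathbf{w}_0-\mathbf{w}^*\|^2\mu\tau}{k}\right).$$
   Context: A convex quadratic function is $F(\mathbf{w})=\frac12\mathbf{w}^\top A\mathbf{w}+\mathbf{b}^\top\mathbf{w}+c$ with $A\in\mathbb{R}^{d\times d}$ positive semi-definite, $\mathbf{b}\in\mathbb{R}^d$, $c\in\mathbb{R}$. It is $\mu$-smooth when all eigenvalues of $A$ lie in $[0,\mu]$, and it is $\lambda$-strongly convex and $\mu$-smooth when they lie in $[\lambda,\mu]$, where $\mu\ge\lambda>0$. Norms are Euclidean; $e=2.718\ldots$ is Euler's number. Stochastic delayed gradient descent (SDGD) with delay $\tau$ and step size $\eta$: given an initial point $\mathbf{w}_0\in\mathbb{R}^d$, set $\mathbf{w}_0=\mathbf{w}_1=\dots=\mathbf{w}_\tau$, and for $k\ge\tau$ set $\mathbf{w}_{k+1}=\mathbf{w}_k-\eta(\nabla F(\mathbf{w}_{k-\tau})+\boldsymbol{\xi}_k)$, where the $\boldsymbol{\xi}_k$ are independent random vectors in $\mathbb{R}^d$ with $\mathbb{E}[\boldsymbol{\xi}_k]=\mathbf{0}$ and $\mathbb{E}[\|\boldsymbol{\xi}_k\|^2]\le\sigma^2$. The notation $\tilde{\mathcal{O}}$ hides constants and factors polylogarithmic in the problem parameters.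
   Formalization: In (1) the printed tuned rate, false for step sizes up to 1/(20μ(τ+1)), is proved with η up to 1/(20μτ), plus a version with (k+1)/(τ+1) in the original interval; the tuned bound in (2) assumes w_0 ≠ w* or σ = 0, since otherwise its right side is 0. *)

theory Defs
  imports "HOL-Probability.Probability"
begin

definition eigenvalue :: "real^'n^'n \<Rightarrow> real \<Rightarrow> bool" where
  "eigenvalue A a \<longleftrightarrow> (\<exists>v. v \<noteq> 0 \<and> A *v v = a *\<^sub>R v)"

definition positive_semidefinite :: "real^'n^'n \<Rightarrow> bool" where
  "positive_semidefinite A \<longleftrightarrow> transpose A = A \<and> (\<forall>v. 0 \<le> v \<bullet> (A *v v))"

definition quadratic :: "real^'n^'n \<Rightarrow> real^'n \<Rightarrow> real \<Rightarrow> real^'n \<Rightarrow> real" where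
  "quadratic A b c w = 1/2 * (w \<bullet> (A *v w)) + b \<bullet> w + c"

definition smooth_convex_quadratic :: "real \<Rightarrow> (real^'n \<Rightarrow> real) \<Rightarrow> bool" where
  "smooth_convex_quadratic \<mu> F \<longleftrightarrow>
     (\<exists>A b c. positive_semidefinite A \<and> F = quadratic A b c \<and>
        (\<forall>a. eigenvalue A a \<longrightarrow> a \<in> {0..\<mu>}))"

definition strongly_convex_smooth_quadratic :: "real \<Rightarrow> real \<Rightarrow> (real^'n \<Rightarrow> real) \<Rightarrow> bool" where
  "strongly_convex_smooth_quadratic lam \<mu> F \<longleftrightarrow>
     (\<exists>A b c. positive_semidefinite A \<and> F = quadratic A b c \<and>
        (\<forall>a. eigenvalue A a \<longrightarrow> a \<in> {lam..\<mu>}))"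

definition grad :: "('v::real_inner \<Rightarrow> real) \<Rightarrow> 'v \<Rightarrow> 'v" where
  "grad F w = (THE g. GDERIV F w :> g)"

text \<open>One realisation of the iterates. The argument \<open>\<xi>\<close> is the realised noise sequence, of which
  only the entries with index at least \<open>\<tau>\<close> are used.\<close>

fun sdgd :: "('v::real_inner \<Rightarrow> real) \<Rightarrow> nat \<Rightarrow> real \<Rightarrow> 'v \<Rightarrow> (nat \<Rightarrow> 'v) \<Rightarrow> nat \<Rightarrow> 'v" where
  "sdgd F \<tau> \<eta> w0 \<xi> 0 = w0"
| "sdgd F \<tau> \<eta> w0 \<xi> (Suc k) =
     (if k < \<tau> then w0
      else sdgd F \<tau> \<eta> w0 \<xi> k - \<eta> *\<^sub>R (grad F (sdgd F \<tau> \<eta> w0 \<xi> (k - \<tau>)) + \<xi> k))"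

text \<open>Measurability of each \<open>\<xi> k\<close> is part of \<^const>\<open>prob_space.indep_vars\<close>; its integrability
  follows from that of \<open>(norm (\<xi> k))\<^sup>2\<close>, so that the integrals below are genuine.\<close>

definition sdgd_noise ::
  "'a measure \<Rightarrow> nat \<Rightarrow> real \<Rightarrow> (nat \<Rightarrow> 'a \<Rightarrow> 'v::euclidean_space) \<Rightarrow> bool" where
  "sdgd_noise M \<tau> \<sigma> \<xi> \<longleftrightarrow>
     prob_space M \<and>
     prob_space.indep_vars M (\<lambda>_. borel) \<xi> {\<tau>..} \<and>
     (\<forall>k\<ge>\<tau>. (\<integral>\<omega>. \<xi> k \<omega> \<partial>M) = 0 \<and>
             integrable M (\<lambda>\<omega>. (norm (\<xi> k \<omega>))\<^sup>2) \<and>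
             (\<integral>\<omega>. (norm (\<xi> k \<omega>))\<^sup>2 \<partial>M) \<le> \<sigma>\<^sup>2)"

definition minimizer :: "('v \<Rightarrow> real) \<Rightarrow> 'v \<Rightarrow> bool" where
  "minimizer F w \<longleftrightarrow> (\<forall>v. F w \<le> F v)"

text \<open>The integrability clause excludes the default value \<open>0\<close> that the Bochner integral takes on
  non-integrable functions.\<close>

definition expectation_le :: "'a measure \<Rightarrow> ('a \<Rightarrow> real) \<Rightarrow> real \<Rightarrow> bool" where
  "expectation_le M X B \<longleftrightarrow> integrable M X \<and> (\<integral>\<omega>. X \<omega> \<partial>M) \<le> B"

text \<open>The soft-O bound: \<open>B\<close> up to a universal constant and a factor polylogarithmic in the positive
  problem parameters \<open>ps\<close>. The constants are numerals, not existentially quantified, because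
  a quantified constant could depend on the type variables of the theorem that uses it, and so
  on the dimension. The values \<open>100\<close> and \<open>2\<close> are not optimised. A parameter that vanishes
  contributes nothing, since \<open>ln 0 = 0\<close>.\<close>

definition soft_O :: "real list \<Rightarrow> real \<Rightarrow> real" where
  "soft_O ps B = 100 * (1 + (\<Sum>p\<leftarrow>ps. \<bar>ln p\<bar>))\<^sup>2 * B"

end

theory Submission
  imports Defs
begin

text \<open>On a quadratic with matrix \<open>A\<close> the error \<open>w\<^sub>k - w\<^sup>*\<close> equals
  \<open>H\<^sub>k (w\<^sub>0 - w\<^sup>*) - \<eta> \<Sum>\<^sub>j H\<^bsub>k-1-j\<^esub> \<xi>\<^sub>j\<close>, where \<open>H\<^sub>m\<close> solves the noiseless delayed recursion
  and is a polynomial in \<open>A\<close>. Independence removes all cross terms from the expected excess, which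
  reduces it to bounds on \<open>a h\<^sub>m(\<eta> a)\<^sup>2\<close> over the eigenvalues \<open>a\<close> of \<open>A\<close>, with \<open>h\<^sub>m(x)\<close> the scalar solution
  of \<open>h\<^bsub>m+1\<^esub> = h\<^sub>m - x h\<^bsub>m-\<tau>\<^esub>\<close>. For \<open>x \<tau> \<le> 1/20\<close> this solution stays positive, hence decreases, hence
  satisfies \<open>h\<^bsub>m+1\<^esub> \<le> (1 - x) h\<^sub>m\<close> from \<open>m = \<tau>\<close> on. The bound \<open>a exp (-s a) \<le> 1/(e s)\<close>
  then sums to a logarithm.\<close>

subsection \<open>Self-adjoint maps\<close>

text \<open>The first-order condition along a line, in a form that serves twice: for the maximiser
  of a Rayleigh quotient and for the minimizer of the objective. With \<open>p\<close> nonzero, a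
  small step against its sign lets the linear term win.\<close>

lemma quadratic_nonneg_imp_linear_zero:
  fixes p q :: real
  assumes "\<And>t. 0 \<le> 2 * p * t + q * t\<^sup>2"
  shows "p = 0"
proof (rule ccontr)
  assume "p \<noteq> 0"
  \<comment> \<open>This \<open>s\<close> is positive and exceeds \<open>q\<close> whatever the sign
    of \<open>q\<close>, so the test point \<open>- p / s\<close> exists and
    \<open>2 * s - q\<close> is positive.\<close>
  define s where "s = \<bar>q\<bar> + 1"
  have s: "s > 0" "q < s" by (auto simp: s_def)
  have "0 \<le> (2 * p * (- p / s) + q * (- p / s)\<^sup>2) * s\<^sup>2"
    using assms[of "- p / s"] by (intro mult_nonneg_nonneg) auto
  also have "\<dots> = - p\<^sup>2 * (2 * s - q)"
    using s by (simp add: field_simps power2_eq_square)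
  also have "\<dots> < 0"
    using s \<open>p \<noteq> 0\<close> by (simp add: mult_less_0_iff)
  finally show False by simp
qed

text \<open>The Rayleigh quotient attains its maximum on the compact unit sphere of
  \<open>V\<close>, and a maximiser is an eigenvector. Invariance of \<open>V\<close> keeps the
  residual \<open>c *\<^sub>R v - f v\<close> inside \<open>V\<close>, where maximality can be
  tested against it.\<close>

lemma self_adjoint_max_eigenvector:
  fixes f :: "'v::euclidean_space \<Rightarrow> 'v"
  assumes f: "linear f" and sym: "\<And>x y. f x \<bullet> y = x \<bullet> f y"
    and V: "subspace V" "f ` V \<subseteq> V" "V \<noteq> {0}"
  obtains v c where "v \<in> V" "v \<noteq> 0" "f v = c *\<^sub>R v" "\<And>u. u \<in> V \<Longrightarrow> u \<bullet> f u \<le> c * (norm u)\<^sup>2"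
proof -
  let ?K = "sphere 0 1 \<inter> V"
  obtain w where w: "w \<in> V" "w \<noteq> 0" using V(1,3) subspace_0 by blast
  have "(1 / norm w) *\<^sub>R w \<in> ?K" using w V(1) by (auto simp: subspace_scale)
  then have ne: "?K \<noteq> {}" by blast
  have cmp: "compact ?K" by (intro compact_Int_closed closed_subspace V) auto
  have cont: "continuous_on ?K (\<lambda>u. u \<bullet> f u)"
    by (intro continuous_intros linear_continuous_on linear_linear[THEN iffD2] f)
  obtain v where v: "v \<in> ?K" and max: "\<And>u. u \<in> ?K \<Longrightarrow> u \<bullet> f u \<le> v \<bullet> f v"
    using continuous_attains_sup[OF cmp ne cont] by blast
  define c where "c = v \<bullet> f v"
  have vv: "v \<bullet> v = 1" using v by (simp add: dot_square_norm)
  have le: "u \<bullet> f u \<le> c * (u \<bullet> u)" if "u \<in> V" for u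
  proof (cases "u = 0")
    case False
    let ?u = "(1 / norm u) *\<^sub>R u"
    have "?u \<in> ?K" using that False V(1) by (auto simp: subspace_scale)
    then have "?u \<bullet> f ?u \<le> c" using max c_def by blast
    also have "?u \<bullet> f ?u = (u \<bullet> f u) / (u \<bullet> u)"
      by (simp add: linear_scale[OF f] dot_square_norm power2_eq_square)
    finally show ?thesis using False by (simp add: pos_divide_le_eq)
  qed simp
  \<comment> \<open>Half the gradient at \<open>v\<close> of
    \<open>c * (u \<bullet> u) - u \<bullet> f u\<close>, which is nonnegative on \<open>V\<close>
    and vanishes at \<open>v\<close>. Along the direction \<open>w\<close> it is a quadratic in
    \<open>t\<close> with linear coefficient \<open>2 * (w \<bullet> w)\<close>.\<close>
  define w where "w = c *\<^sub>R v - f v"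
  have wV: "w \<in> V" unfolding w_def
    using v V by (intro subspace_diff subspace_scale) auto
  have "w \<bullet> w = 0"
  proof (rule quadratic_nonneg_imp_linear_zero)
    fix t
    have "v + t *\<^sub>R w \<in> V" using v wV V(1) by (auto intro!: subspace_add subspace_scale)
    then have "0 \<le> c * ((v + t *\<^sub>R w) \<bullet> (v + t *\<^sub>R w)) - (v + t *\<^sub>R w) \<bullet> f (v + t *\<^sub>R w)"
      using le by simp
    also have "\<dots> = 2 * (w \<bullet> w) * t + (c * (w \<bullet> w) - w \<bullet> f w) * t\<^sup>2"
    proof -
      have "v \<bullet> f w = w \<bullet> f v" by (metis sym inner_commute)
      moreover have "w \<bullet> w = c * (w \<bullet> v) - w \<bullet> f v"
        unfolding w_def by (simp add: inner_diff_right)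
      ultimately show ?thesis
        by (simp add: linear_add[OF f] linear_scale[OF f] inner_add_left inner_add_right
              inner_commute[of v w] vv flip: c_def, simp add: algebra_simps power2_eq_square)
    qed
    finally show "0 \<le> 2 * (w \<bullet> w) * t + (c * (w \<bullet> w) - w \<bullet> f w) * t\<^sup>2" .
  qed
  then have "f v = c *\<^sub>R v" by (simp add: w_def)
  moreover have "v \<noteq> 0" using vv by auto
  ultimately show ?thesis using that[of v c] v le by (auto simp: dot_square_norm)
qed

text \<open>The top eigenspace of \<open>g\<close> is invariant under \<open>f\<close> and so contains an eigenvector of \<open>f\<close>. This
  replaces a simultaneous diagonalisation.\<close>

lemma commuting_self_adjoint_common_eigenvector:
  fixes f g :: "'v::euclidean_space \<Rightarrow> 'v"
  assumes f: "linear f" "\<And>x y. f x \<bullet> y = x \<bullet> f y"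
    and g: "linear g" "\<And>x y. g x \<bullet> y = x \<bullet> g y"
    and comm: "\<And>x. f (g x) = g (f x)"
  obtains v a c where "v \<noteq> 0" "f v = a *\<^sub>R v" "g v = c *\<^sub>R v" "\<And>u. u \<bullet> g u \<le> c * (norm u)\<^sup>2"
proof -
  obtain b :: 'v where "b \<in> Basis" using nonempty_Basis by blast
  then have "(UNIV :: 'v set) \<noteq> {0}" using nonzero_Basis by blast
  then obtain w c where w: "w \<noteq> 0" "g w = c *\<^sub>R w" and c: "\<And>u. u \<bullet> g u \<le> c * (norm u)\<^sup>2"
    using self_adjoint_max_eigenvector[OF g, of UNIV] by auto
  let ?V = "{v. g v = c *\<^sub>R v}"
  have "subspace ?V"
    by (rule subspaceI) (auto simp: linear_0[OF g(1)] linear_add[OF g(1)] linear_scale[OF g(1)] algebra_simps)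
  moreover have "f ` ?V \<subseteq> ?V" by (auto simp: linear_scale[OF f(1)] simp flip: comm)
  moreover have "?V \<noteq> {0}" using w by blast
  ultimately obtain v a where "v \<in> ?V" "v \<noteq> 0" "f v = a *\<^sub>R v"
    using self_adjoint_max_eigenvector[OF f, of ?V] by metis
  then show ?thesis using that c by blast
qed

subsection \<open>The delayed linear recursion\<close>

text \<open>Polymorphic in the space, so that one recursion gives both the operators
  \<open>H\<^sub>m\<close>, with \<open>T\<close> the map \<open>\<eta> A\<close>, and the scalars
  \<open>h\<^sub>m(x)\<close>, with \<open>T\<close> multiplication by \<open>x\<close> on the
  reals.\<close>

fun delayed :: "('v::real_vector \<Rightarrow> 'v) \<Rightarrow> nat \<Rightarrow> nat \<Rightarrow> 'v \<Rightarrow> 'v" where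
  "delayed T d 0 v = v"
| "delayed T d (Suc m) v =
     (if m < d then v else delayed T d m v - T (delayed T d (m - d) v))"

lemma delayed_initial: "m \<le> d \<Longrightarrow> delayed T d m v = v"
  by (cases m) auto

lemma linear_delayed:
  assumes T: "linear T"
  shows "linear (delayed T d m)"
proof -
  have "delayed T d m (x + y) = delayed T d m x + delayed T d m y" for x y
  proof (induction m rule: less_induct)
    case (less m)
    then show ?case by (cases m) (auto simp: linear_add[OF T])
  qed
  moreover have "delayed T d m (r *\<^sub>R x) = r *\<^sub>R delayed T d m x" for r x
  proof (induction m rule: less_induct)
    case (less m)
    then show ?case by (cases m) (auto simp: linear_scale[OF T] scaleR_diff_right)
  qed
  ultimately show ?thesis by (rule linearI)
qed

text \<open>The delayed term is a product of two self-adjoint maps; it is self-adjoint because they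
  commute.\<close>

lemma self_adjoint_delayed:
  fixes T :: "'v::real_inner \<Rightarrow> 'v"
  assumes "\<And>x y. T x \<bullet> y = x \<bullet> T y" and comm: "\<And>m x. delayed T d m (T x) = T (delayed T d m x)"
  shows "delayed T d m x \<bullet> y = x \<bullet> delayed T d m y"
proof (induction m arbitrary: x y rule: less_induct)
  case (less m)
  show ?case
  proof (cases m)
    case (Suc n)
    have "T (delayed T d (n - d) x) \<bullet> y = x \<bullet> T (delayed T d (n - d) y)"
      using less[of "n - d" x "T y"] Suc by (simp add: assms)
    then show ?thesis using Suc less[of n x y] by (auto simp: inner_diff_left inner_diff_right)
  qed simp
qed

lemma delayed_commute:
  assumes T: "linear T" and S: "linear S" and ST: "\<And>x. S (T x) = T (S x)"
  shows "delayed T d m (S x) = S (delayed T d m x)"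
proof (induction m rule: less_induct)
  case (less m)
  then show ?case
    by (cases m) (auto simp: linear_diff[OF S] ST)
qed

text \<open>On an eigenline of \<open>T\<close> the operator recursion collapses to the scalar one,
  where all decay estimates are made.\<close>

lemma delayed_eigenvector:
  assumes T: "linear T" and v: "T v = x *\<^sub>R v"
  shows "delayed T d m v = delayed (\<lambda>y. x * y) d m (1::real) *\<^sub>R v"
proof (induction m rule: less_induct)
  case (less m)
  then show ?case
    by (cases m) (auto simp: linear_scale[OF T] v scaleR_diff_left)
qed

text \<open>The map \<open>g = H f H\<close> is self-adjoint and commutes with \<open>f\<close>. Its
  largest eigenvalue dominates the form and, read off on a common eigenvector, equals
  \<open>a\<close> times the squared scalar solution for some eigenvalue \<open>a\<close> of
  \<open>f\<close>.\<close>

lemma delayed_quadratic_form_le: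
  fixes f :: "'v::euclidean_space \<Rightarrow> 'v"
  assumes f: "linear f" and sym: "\<And>x y. f x \<bullet> y = x \<bullet> f y"
    and C: "\<And>a v. v \<noteq> 0 \<Longrightarrow> f v = a *\<^sub>R v \<Longrightarrow> a * (delayed (\<lambda>y. \<eta> * a * y) d m 1)\<^sup>2 \<le> C"
  defines "T \<equiv> \<lambda>x. \<eta> *\<^sub>R f x"
  shows "delayed T d m u \<bullet> f (delayed T d m u) \<le> C * (norm u)\<^sup>2"
proof -
  let ?H = "delayed T d m"
  have T: "linear T" unfolding T_def by (intro linear_compose_scale_right f)
  have H: "linear ?H" by (rule linear_delayed[OF T])
  have fT: "f (T x) = T (f x)" for x by (simp add: T_def linear_scale[OF f])
  have Hf: "delayed T d n (f x) = f (delayed T d n x)" for n x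
    by (rule delayed_commute[OF T f]) (rule fT)
  have symH: "?H x \<bullet> y = x \<bullet> ?H y" for x y
  proof (rule self_adjoint_delayed)
    show "T x \<bullet> y = x \<bullet> T y" for x y by (simp add: T_def sym)
    show "delayed T d m (T x) = T (delayed T d m x)" for m x
      by (rule delayed_commute[OF T T]) simp
  qed
  define g where "g = (\<lambda>x. ?H (f (?H x)))"
  have g: "linear g" unfolding g_def
    using linear_compose[OF linear_compose[OF H f] H] by (simp add: o_def)
  obtain v a c where v: "v \<noteq> 0" "f v = a *\<^sub>R v" "g v = c *\<^sub>R v"
    and c: "\<And>u. u \<bullet> g u \<le> c * (norm u)\<^sup>2"
    using commuting_self_adjoint_common_eigenvector[OF f sym g]
    by (metis (no_types, lifting) g_def sym symH Hf)
  have "T v = (\<eta> * a) *\<^sub>R v" by (simp add: T_def v)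
  from delayed_eigenvector[OF T this]
  have "?H v = delayed (\<lambda>y. \<eta> * a * y) d m 1 *\<^sub>R v" .
  then have "g v = (a * (delayed (\<lambda>y. \<eta> * a * y) d m 1)\<^sup>2) *\<^sub>R v"
    unfolding g_def by (simp add: linear_scale[OF f] linear_scale[OF H] v power2_eq_square)
  then have "c = a * (delayed (\<lambda>y. \<eta> * a * y) d m 1)\<^sup>2" using v by simp
  then have "c \<le> C" using C v by simp
  have "?H u \<bullet> f (?H u) = u \<bullet> g u" unfolding g_def by (simp add: symH)
  also have "\<dots> \<le> c * (norm u)\<^sup>2" by (rule c)
  also have "\<dots> \<le> C * (norm u)\<^sup>2" using \<open>c \<le> C\<close> by (intro mult_right_mono) auto
  finally show ?thesis .
qed

text \<open>The recursion is non-oscillating for small \<open>x\<close>: each step shrinks the solution by a factor of at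
  least \<open>1 - 2 x\<close>, which keeps it positive, so that it is also decreasing.\<close>

lemma delayed_scalar_step:
  fixes x :: real
  assumes x: "0 \<le> x" "x * real d \<le> 1 / 20" "x \<le> 1 / 20"
  defines "h \<equiv> \<lambda>m. delayed (\<lambda>y. x * y) d m 1"
  shows "0 < h m \<and> (1 - 2 * x) * h m \<le> h (Suc m) \<and> h (Suc m) \<le> h m"
proof (induction m rule: less_induct)
  case (less m)
  have r: "0 < 1 - 2 * x" using x by simp
  have pos: "0 < h m"
  proof (cases m)
    case (Suc n)
    have "0 < (1 - 2 * x) * h n" using less[of n] Suc r by simp
    also have "\<dots> \<le> h m" using less[of n] Suc by simp
    finally show ?thesis .
  qed (simp add: h_def)
  show ?case
  proof (cases "m < d")
    case True
    then have "h m = 1" "h (Suc m) = 1" unfolding h_def by (auto simp: delayed_initial)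
    then show ?thesis using x by simp
  next
    case False
    have step: "h (Suc m) = h m - x * h (m - d)" using False by (simp add: h_def)
    \<comment> \<open>Chaining the lower ratio over the last \<open>d\<close> steps compares the
      delayed value \<open>h (m - d)\<close> with the current \<open>h m\<close>.\<close>
    have "i \<le> d \<Longrightarrow> (1 - 2 * x) ^ i * h (m - d) \<le> h (m - d + i)" for i
    proof (induction i)
      case (Suc i)
      have "(1 - 2 * x) ^ Suc i * h (m - d) \<le> (1 - 2 * x) * h (m - d + i)"
        using Suc r by (simp add: mult.assoc)
      also have "\<dots> \<le> h (m - d + Suc i)" using less[of "m - d + i"] Suc False by simp
      finally show ?case .
    qed simp
    from this[of d] have 1: "(1 - 2 * x) ^ d * h (m - d) \<le> h m" using False by simp
    \<comment> \<open>Bernoulli gives at least 9/10, and 1/2 is already enough: it yields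
      \<open>h (m - d) \<le> 2 * h m\<close>, and this factor 2 is the one in the ratio
      \<open>1 - 2 * x\<close>, which closes the induction.\<close>
    have "1 + real d * (- 2 * x) \<le> (1 + - 2 * x) ^ d"
      by (rule Bernoulli_inequality) (use x in simp)
    then have "1 / 2 \<le> (1 - 2 * x) ^ d" using x by (simp add: algebra_simps)
    \<comment> \<open>For \<open>d = 0\<close> the index \<open>m - d\<close> is \<open>m\<close>
      itself, outside the induction hypothesis, and \<open>pos\<close> takes over.\<close>
    moreover have nonneg: "0 \<le> h (m - d)"
      using less[of "m - d"] pos False by (cases "d = 0") (auto intro: less_imp_le)
    ultimately have "1 / 2 * h (m - d) \<le> h m"
      using mult_right_mono 1 order_trans by blast
    then have "x * h (m - d) \<le> 2 * x * h m"
      using mult_left_mono[of "h (m - d)" "2 * h m" x] x by (simp add: ac_simps)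
    moreover have "0 \<le> x * h (m - d)" using x nonneg by simp
    ultimately show ?thesis using pos step by (simp add: algebra_simps)
  qed
qed

text \<open>Since the solution decreases, the delayed value is at least the current one, so every
  step from \<open>d\<close> on contracts by \<open>1 - x\<close>. Starting the exponential at
  \<open>- 1\<close> instead of \<open>d\<close> costs only a constant factor.\<close>

lemma delayed_scalar_le:
  fixes x :: real
  assumes x: "0 \<le> x" "x * real d \<le> 1 / 20" and d: "d > 0"
  defines "h \<equiv> \<lambda>m. delayed (\<lambda>y. x * y) d m 1"
  shows "0 < h m" and "h m \<le> 10 / 9 * exp (- x * (real m + 1))"
proof -
  \<comment> \<open>A delay of at least 1 turns the bound on \<open>x * real d\<close> into one on
    \<open>x\<close>.\<close>
  have x1: "x \<le> 1 / 20"
    using x d mult_left_mono[of 1 "real d" x] by simp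
  have step: "0 < h m \<and> (1 - 2 * x) * h m \<le> h (Suc m) \<and> h (Suc m) \<le> h m" for m
    unfolding h_def by (rule delayed_scalar_step[OF x x1])
  show "0 < h m" using step by blast
  have dec: "antimono h" using step by (intro decseq_SucI) blast
  have *: "h (d + i) \<le> (1 - x) ^ i" for i
  proof (induction i)
    case (Suc i)
    have "h (d + Suc i) = h (d + i) - x * h i" by (simp add: h_def)
    also have "\<dots> \<le> h (d + i) - x * h (d + i)"
      using x antimonoD[OF dec, of i "d + i"] by (simp add: mult_left_mono)
    also have "\<dots> = (1 - x) * h (d + i)" by (simp add: algebra_simps)
    also have "\<dots> \<le> (1 - x) * (1 - x) ^ i"
      using x1 Suc by (intro mult_left_mono) auto
    finally show ?case by simp
  qed (simp add: h_def delayed_initial)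
  have **: "h m \<le> exp (- x * (real m - real d))"
  proof (cases "m \<le> d")
    case True
    then have "h m = 1" by (simp add: h_def delayed_initial)
    moreover have "0 \<le> x * (real d - real m)" using True x by simp
    ultimately show ?thesis by (simp add: algebra_simps)
  next
    case False
    then have "h m \<le> (1 - x) ^ (m - d)" using *[of "m - d"] by simp
    also have "\<dots> \<le> exp (- x) ^ (m - d)"
      using x1 exp_ge_add_one_self[of "- x"] by (intro power_mono) auto
    also have "\<dots> = exp (- x * (real m - real d))"
      using False by (simp add: of_nat_diff mult.commute flip: exp_of_nat_mult)
    finally show ?thesis .
  qed
  also have "\<dots> = exp (x * (real d + 1)) * exp (- x * (real m + 1))"
    by (simp add: algebra_simps flip: exp_add)
  \<comment> \<open>The price of replacing \<open>m - d\<close> by \<open>m + 1\<close> in the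
    exponent: both \<open>x * real d\<close> and \<open>x\<close> are at most 1/20, so the factor is
    at most 1 / (1 - 1/10).\<close>
  also have "exp (x * (real d + 1)) \<le> 10 / 9"
  proof -
    have le: "x * (real d + 1) \<le> 1 / 10" using x x1 by (simp add: algebra_simps)
    then have "9 / 10 \<le> exp (- (x * (real d + 1)))"
      using exp_ge_add_one_self[of "- (x * (real d + 1))"] by linarith
    then have "9 / 10 * exp (x * (real d + 1)) \<le> exp (- (x * (real d + 1))) * exp (x * (real d + 1))"
      by (intro mult_right_mono) auto
    then show ?thesis by (simp flip: exp_add)
  qed
  finally show "h m \<le> 10 / 9 * exp (- x * (real m + 1))" by simp
qed

text \<open>The maximum over \<open>a\<close> is attained at \<open>a = 1 / s\<close>; the tangent
  inequality for \<open>exp\<close> at \<open>s * a - 1\<close> gives it without calculus.\<close>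

lemma mult_exp_minus_le:
  fixes a s :: real
  assumes "s > 0"
  shows "a * exp (- (s * a)) \<le> 1 / (exp 1 * s)"
proof -
  have "s * a \<le> exp (s * a - 1)" using exp_ge_add_one_self[of "s * a - 1"] by simp
  then have "s * a * exp (- (s * a)) \<le> exp (s * a - 1) * exp (- (s * a))"
    by (intro mult_right_mono) auto
  also have "\<dots> = 1 / exp 1" by (simp flip: exp_add) (simp add: exp_minus field_simps)
  finally show ?thesis using assms by (simp add: field_simps)
qed

subsection \<open>Quadratic forms of independent sums\<close>

lemma (in prob_space) indep_vars_imp_indep_var:
  assumes X: "indep_vars M' X I" and "i \<in> I" "j \<in> I" "i \<noteq> j"
  shows "indep_var (M' i) (X i) (M' j) (X j)"
proof -
  have "indep_var (PiM {i} M') (\<lambda>\<omega>. restrict (\<lambda>l. X l \<omega>) {i})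
      (PiM {j} M') (\<lambda>\<omega>. restrict (\<lambda>l. X l \<omega>) {j})"
    by (rule indep_var_restrict[OF X]) (use assms in auto)
  from indep_var_compose[OF this, of "\<lambda>f. f i" "M' i" "\<lambda>f. f j" "M' j"]
  show ?thesis by (simp add: o_def)
qed

lemma linear_borel_measurable:
  fixes f :: "'v::euclidean_space \<Rightarrow> 'w::euclidean_space"
  assumes "linear f"
  shows "f \<in> borel_measurable borel"
  using assms by (intro borel_measurable_continuous_onI linear_continuous_on) (simp add: linear_linear)

text \<open>Expanding the inner product in coordinates reduces the claim to the product rule for
  independent real variables.\<close>

lemma (in prob_space) indep_mean_zero_inner:
  fixes X Y :: "'a \<Rightarrow> 'v::euclidean_space"
  assumes ind: "indep_var borel X borel Y" and X: "integrable M X" and Y: "integrable M Y"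
    and Y0: "expectation Y = 0" and f: "linear f"
  shows "integrable M (\<lambda>\<omega>. X \<omega> \<bullet> f (Y \<omega>))" and "expectation (\<lambda>\<omega>. X \<omega> \<bullet> f (Y \<omega>)) = 0"
proof -
  have bf: "bounded_linear f" using f by (simp add: linear_linear)
  have iY: "integrable M (\<lambda>\<omega>. f (Y \<omega>))" by (rule integrable_bounded_linear[OF bf Y])
  have eY: "expectation (\<lambda>\<omega>. f (Y \<omega>)) = 0"
    using integral_bounded_linear[OF bf Y] Y0 linear_0[OF f] by simp
  have ind': "indep_var borel (\<lambda>\<omega>. X \<omega> \<bullet> b) borel (\<lambda>\<omega>. f (Y \<omega>) \<bullet> b)" for b
  proof -
    have [measurable]: "f \<in> borel_measurable borel" by (rule linear_borel_measurable[OF f])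
    show ?thesis
      using indep_var_compose[OF ind, of "\<lambda>x. x \<bullet> b" borel "\<lambda>y. f y \<bullet> b" borel] by (simp add: o_def)
  qed
  have sum: "(\<lambda>\<omega>. X \<omega> \<bullet> f (Y \<omega>)) = (\<lambda>\<omega>. \<Sum>b\<in>Basis. (X \<omega> \<bullet> b) * (f (Y \<omega>) \<bullet> b))"
    by (rule ext) (rule euclidean_inner)
  have int: "integrable M (\<lambda>\<omega>. (X \<omega> \<bullet> b) * (f (Y \<omega>) \<bullet> b))" for b
    by (rule indep_var_integrable[OF ind']) (use X iY in auto)
  have zero: "expectation (\<lambda>\<omega>. (X \<omega> \<bullet> b) * (f (Y \<omega>) \<bullet> b)) = 0" for b
    using indep_var_lebesgue_integral[OF ind', of b] X iY eY by simp
  show "integrable M (\<lambda>\<omega>. X \<omega> \<bullet> f (Y \<omega>))" unfolding sum using int by simp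
  show "expectation (\<lambda>\<omega>. X \<omega> \<bullet> f (Y \<omega>)) = 0" unfolding sum using int zero by simp
qed

text \<open>Adding one summand at a time creates only cross terms that pair the new variable with
  \<open>u\<close> or with a single earlier one. Each has mean zero, so pairwise independence is
  what is assumed.\<close>

lemma (in prob_space) quadratic_form_indep_sum:
  fixes X :: "'i \<Rightarrow> 'a \<Rightarrow> 'v::euclidean_space" and u :: 'v
  assumes f: "linear f" and sym: "\<And>x y. f x \<bullet> y = x \<bullet> f y" and J: "finite J"
    and ind: "\<And>i j. i \<in> J \<Longrightarrow> j \<in> J \<Longrightarrow> i \<noteq> j \<Longrightarrow> indep_var borel (X i) borel (X j)"
    and int: "\<And>j. j \<in> J \<Longrightarrow> integrable M (X j)"
    and zero: "\<And>j. j \<in> J \<Longrightarrow> expectation (X j) = 0"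
    and sq: "\<And>j. j \<in> J \<Longrightarrow> integrable M (\<lambda>\<omega>. X j \<omega> \<bullet> f (X j \<omega>))"
  defines "Z \<equiv> \<lambda>J \<omega>. u + (\<Sum>j\<in>J. X j \<omega>)"
  shows "integrable M (\<lambda>\<omega>. Z J \<omega> \<bullet> f (Z J \<omega>)) \<and>
    expectation (\<lambda>\<omega>. Z J \<omega> \<bullet> f (Z J \<omega>)) = u \<bullet> f u + (\<Sum>j\<in>J. expectation (\<lambda>\<omega>. X j \<omega> \<bullet> f (X j \<omega>)))"
  using J ind int zero sq
proof (induction J rule: finite_induct)
  case empty
  then show ?case by (simp add: Z_def prob_space)
next
  case (insert i J)
  let ?q = "\<lambda>\<omega>. Z J \<omega> \<bullet> f (Z J \<omega>)" and ?c = "\<lambda>\<omega>. Z J \<omega> \<bullet> f (X i \<omega>)"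
    and ?s = "\<lambda>\<omega>. X i \<omega> \<bullet> f (X i \<omega>)"
  have IH: "integrable M ?q"
    "expectation ?q = u \<bullet> f u + (\<Sum>j\<in>J. expectation (\<lambda>\<omega>. X j \<omega> \<bullet> f (X j \<omega>)))"
    using insert by auto
  have Xi: "integrable M (X i)" "expectation (X i) = 0" "integrable M ?s" using insert by auto
  have bf: "bounded_linear f" using f by (simp add: linear_linear)
  have cross: "integrable M (\<lambda>\<omega>. X j \<omega> \<bullet> f (X i \<omega>)) \<and> expectation (\<lambda>\<omega>. X j \<omega> \<bullet> f (X i \<omega>)) = 0"
    if "j \<in> J" for j
    using insert that Xi indep_mean_zero_inner[OF _ _ _ _ f, of "X j" "X i"] by auto
  have const: "integrable M (\<lambda>\<omega>. u \<bullet> f (X i \<omega>))" "expectation (\<lambda>\<omega>. u \<bullet> f (X i \<omega>)) = 0"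
    using integrable_bounded_linear[OF bf Xi(1)] integral_bounded_linear[OF bf Xi(1)] Xi(2) linear_0[OF f]
    by auto
  have c: "?c = (\<lambda>\<omega>. u \<bullet> f (X i \<omega>) + (\<Sum>j\<in>J. X j \<omega> \<bullet> f (X i \<omega>)))"
    by (simp add: Z_def inner_add_left inner_sum_left)
  have ci: "integrable M ?c" "expectation ?c = 0"
    unfolding c using const cross by (auto simp: Bochner_Integration.integral_add Bochner_Integration.integral_sum)
  \<comment> \<open>By symmetry of \<open>f\<close> the two mixed terms coincide, which gives the
    factor 2.\<close>
  have Z: "Z (insert i J) \<omega> \<bullet> f (Z (insert i J) \<omega>) = ?q \<omega> + 2 * ?c \<omega> + ?s \<omega>" for \<omega>
  proof -
    have "Z (insert i J) \<omega> = Z J \<omega> + X i \<omega>" using insert by (simp add: Z_def algebra_simps)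
    moreover have "X i \<omega> \<bullet> f (Z J \<omega>) = Z J \<omega> \<bullet> f (X i \<omega>)" by (metis sym inner_commute)
    ultimately show ?thesis by (simp add: linear_add[OF f] inner_add_left inner_add_right)
  qed
  show ?case unfolding Z using insert IH ci Xi by simp
qed

text \<open>Provides the integrable majorant by which finite second moments of the noise make its
  quadratic forms integrable.\<close>

lemma linear_quadratic_form_bounded:
  fixes f :: "'v::euclidean_space \<Rightarrow> 'v"
  assumes "linear f"
  obtains K where "\<And>u. \<bar>u \<bullet> f u\<bar> \<le> K * (norm u)\<^sup>2"
proof -
  obtain K where K: "\<And>x. norm (f x) \<le> K * norm x" using linear_bounded[OF assms] by blast
  have "\<bar>u \<bullet> f u\<bar> \<le> K * (norm u)\<^sup>2" for u
  proof -
    have "\<bar>u \<bullet> f u\<bar> \<le> norm u * norm (f u)" by (rule Cauchy_Schwarz_ineq2)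
    also have "\<dots> \<le> norm u * (K * norm u)" by (intro mult_left_mono K) auto
    finally show ?thesis by (simp add: power2_eq_square ac_simps)
  qed
  then show thesis by (rule that)
qed

subsection \<open>The iterates on a quadratic\<close>

lemma symmetric_matrix_inner:
  fixes A :: "real^'n^'n"
  assumes "transpose A = A"
  shows "(A *v x) \<bullet> y = x \<bullet> (A *v y)"
  by (metis assms dot_lmul_matrix transpose_matrix_vector)

lemma grad_quadratic:
  fixes A :: "real^'n^'n"
  assumes "transpose A = A"
  shows "grad (quadratic A b c) w = A *v w + b"
proof -
  have "((\<lambda>w. 1/2 * (w \<bullet> (A *v w)) + b \<bullet> w + c) has_derivative
      (\<lambda>h. 1/2 * (w \<bullet> (A *v h) + h \<bullet> (A *v w)) + b \<bullet> h)) (at w)"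
    by (auto intro!: derivative_eq_intros bounded_linear.has_derivative[OF matrix_vector_mul_bounded_linear])
  moreover have "1/2 * (w \<bullet> (A *v h) + h \<bullet> (A *v w)) + b \<bullet> h = h \<bullet> (A *v w + b)" for h
    using symmetric_matrix_inner[OF assms, of w h] by (simp add: inner_add_right inner_commute)
  ultimately have D: "GDERIV (quadratic A b c) w :> A *v w + b"
    unfolding gderiv_def quadratic_def by simp
  \<comment> \<open>As \<open>grad\<close> is a definite description, uniqueness is needed besides
    existence. Equal derivative maps give equal inner products with every \<open>h\<close>.\<close>
  have "g = A *v w + b" if "GDERIV (quadratic A b c) w :> g" for g
  proof -
    have "(\<lambda>h. h \<bullet> g) = (\<lambda>h. h \<bullet> (A *v w + b))"
      using that D has_derivative_unique unfolding gderiv_def by blast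
    then have "h \<bullet> (g - (A *v w + b)) = 0" for h by (metis diff_self inner_diff_right)
    then show ?thesis using inner_eq_zero_iff by (metis right_minus_eq)
  qed
  then show ?thesis unfolding grad_def using D by (intro the_equality)
qed

lemma quadratic_add:
  assumes "transpose A = A"
  shows "quadratic A b c (w + v) = quadratic A b c w + v \<bullet> (A *v w + b) + 1/2 * (v \<bullet> (A *v v))"
  using symmetric_matrix_inner[OF assms, of w v]
  by (simp add: quadratic_def inner_add_left inner_add_right matrix_vector_right_distrib inner_commute
      algebra_simps)

lemma quadratic_minimizer_gradient_zero:
  assumes A: "transpose A = A" and "minimizer (quadratic A b c) w"
  shows "A *v w + b = 0"
proof -
  have "v \<bullet> (A *v w + b) = 0" for v
  proof (rule quadratic_nonneg_imp_linear_zero)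
    fix t
    \<comment> \<open>Doubling clears the 1/2 of the quadratic, so that \<open>p\<close> is the
      directional derivative along \<open>v\<close>.\<close>
    have "0 \<le> 2 * (quadratic A b c (w + t *\<^sub>R v) - quadratic A b c w)"
      using assms(2) by (simp add: minimizer_def)
    also have "\<dots> = 2 * (v \<bullet> (A *v w + b)) * t + (v \<bullet> (A *v v)) * t\<^sup>2"
      unfolding quadratic_add[OF A] by (simp add: algebra_simps power2_eq_square matrix_vector_mult_scaleR)
    finally show "0 \<le> 2 * (v \<bullet> (A *v w + b)) * t + (v \<bullet> (A *v v)) * t\<^sup>2" .
  qed
  then show ?thesis using inner_eq_zero_iff by blast
qed

text \<open>Variation of constants. The noise \<open>\<xi> j\<close> first shows in iterate
  \<open>j + 1\<close>, so at time \<open>k\<close> it has evolved for \<open>k - 1 - j\<close>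
  steps. An impulse has no past, so its delayed gradient vanishes during its first
  \<open>\<tau>\<close> steps, which matches the flat start of \<open>delayed\<close>.\<close>

lemma sdgd_quadratic_error:
  fixes A :: "real^'n^'n" and \<eta> :: real
  assumes A: "transpose A = A" and w: "A *v w + b = 0"
  defines "T \<equiv> \<lambda>x. \<eta> *\<^sub>R (A *v x)"
  shows "sdgd (quadratic A b c) \<tau> \<eta> w0 \<xi> k - w =
    delayed T \<tau> k (w0 - w) + (\<Sum>j\<in>{\<tau>..<k}. delayed T \<tau> (k - 1 - j) (- \<eta> *\<^sub>R \<xi> j))"
proof (induction k rule: less_induct)
  case (less k)
  have T: "linear T" unfolding T_def by (intro linear_compose_scale_right) simp
  let ?e = "\<lambda>k. sdgd (quadratic A b c) \<tau> \<eta> w0 \<xi> k - w"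
  let ?H = "\<lambda>m. delayed T \<tau> m"
  show ?case
  proof (cases k)
    case (Suc n)
    show ?thesis
    proof (cases "n < \<tau>")
      case False
      have b: "b = - (A *v w)" using w by (simp add: eq_neg_iff_add_eq_0 add.commute)
      have "?e (Suc n) = ?e n - T (?e (n - \<tau>)) - \<eta> *\<^sub>R \<xi> n"
        using False
        by (simp add: grad_quadratic[OF A] T_def b matrix_vector_mult_diff_distrib algebra_simps)
      also have "\<dots> = ?H (Suc n) (w0 - w) + ((\<Sum>j\<in>{\<tau>..<n}. ?H (n - 1 - j) (- \<eta> *\<^sub>R \<xi> j))
          - (\<Sum>j\<in>{\<tau>..<n - \<tau>}. T (?H (n - \<tau> - 1 - j) (- \<eta> *\<^sub>R \<xi> j))) - \<eta> *\<^sub>R \<xi> n)"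
        using less[of n] less[of "n - \<tau>"] Suc False
        by (simp add: linear_add[OF T] linear_sum[OF T])
      \<comment> \<open>Noise with \<open>j \<ge> n - \<tau>\<close> has not yet reached the delayed
        gradient. Padding by zeros puts both sums on one index range.\<close>
      also have "(\<Sum>j\<in>{\<tau>..<n - \<tau>}. T (?H (n - \<tau> - 1 - j) (- \<eta> *\<^sub>R \<xi> j))) =
          (\<Sum>j\<in>{\<tau>..<n}. if j < n - \<tau> then T (?H (n - \<tau> - 1 - j) (- \<eta> *\<^sub>R \<xi> j)) else 0)"
        by (intro sum.mono_neutral_cong_left) auto
      also have "(\<Sum>j\<in>{\<tau>..<n}. ?H (n - 1 - j) (- \<eta> *\<^sub>R \<xi> j)) - \<dots> =
          (\<Sum>j\<in>{\<tau>..<n}. ?H (n - j) (- \<eta> *\<^sub>R \<xi> j))"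
        unfolding sum_subtractf[symmetric]
      proof (intro sum.cong refl)
        fix j assume "j \<in> {\<tau>..<n}"
        \<comment> \<open>Here \<open>i\<close> is the age of the impulse. Below age
          \<open>\<tau>\<close> the padded term is 0 and both \<open>?H\<close> values are the
          identity; from then on the claim is the recursion itself.\<close>
        then obtain i where i: "n = Suc (j + i)" using less_imp_Suc_add by auto
        show "?H (n - 1 - j) (- \<eta> *\<^sub>R \<xi> j) - (if j < n - \<tau> then T (?H (n - \<tau> - 1 - j) (- \<eta> *\<^sub>R \<xi> j)) else 0)
            = ?H (n - j) (- \<eta> *\<^sub>R \<xi> j)"
        proof (cases "i < \<tau>")
          case True
          then show ?thesis by (simp add: i delayed_initial)
        next
          case False
          then have "n - \<tau> - 1 - j = i - \<tau>" using i by simp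
          then show ?thesis using False by (simp add: i Suc_diff_le)
        qed
      qed
      also have "\<dots> - \<eta> *\<^sub>R \<xi> n = (\<Sum>j\<in>{\<tau>..<Suc n}. ?H (Suc n - 1 - j) (- \<eta> *\<^sub>R \<xi> j))"
        using False by simp
      finally show ?thesis using Suc by simp
    qed (simp add: Suc)
  qed simp
qed

text \<open>Reduces the stochastic problem to scalar bounds over the spectrum: the initial error is
  charged \<open>C k\<close>, and each noise vector is charged \<open>C\<close> at its age, all ages
  being below \<open>k\<close>.\<close>

lemma sdgd_expectation_le:
  fixes A :: "real^'n^'n" and C :: "nat \<Rightarrow> real"
  assumes A: "transpose A = A" and F: "F = quadratic A b c" and w: "minimizer F w"
    and noise: "sdgd_noise M \<tau> \<sigma> \<xi>"
    and C: "\<And>a m. eigenvalue A a \<Longrightarrow> a * (delayed (\<lambda>y. \<eta> * a * y) \<tau> m 1)\<^sup>2 \<le> C m" "\<And>m. 0 \<le> C m"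
  shows "expectation_le M (\<lambda>\<omega>. F (sdgd F \<tau> \<eta> w0 (\<lambda>j. \<xi> j \<omega>) k) - F w)
    (1/2 * (C k * (norm (w0 - w))\<^sup>2 + \<eta>\<^sup>2 * \<sigma>\<^sup>2 * (\<Sum>m<k. C m)))"
proof -
  interpret prob_space M using noise by (simp add: sdgd_noise_def)
  define T where "T = (\<lambda>x. \<eta> *\<^sub>R (A *v x))"
  have T: "linear T" unfolding T_def by (intro linear_compose_scale_right) simp
  have f: "linear ((*v) A)" by simp
  note sym = symmetric_matrix_inner[OF A]
  have w0: "A *v w + b = 0" using quadratic_minimizer_gradient_zero[OF A] w F by blast
  have form: "delayed T \<tau> m u \<bullet> (A *v delayed T \<tau> m u) \<le> C m * (norm u)\<^sup>2" for m u
    unfolding T_def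
    by (rule delayed_quadratic_form_le[OF f sym]) (use C(1) eigenvalue_def in blast)
  define X where "X = (\<lambda>j \<omega>. delayed T \<tau> (k - 1 - j) (- \<eta> *\<^sub>R \<xi> j \<omega>))"
  define u where "u = delayed T \<tau> k (w0 - w)"
  let ?J = "{\<tau>..<k}"
  let ?Z = "\<lambda>\<omega>. u + (\<Sum>j\<in>?J. X j \<omega>)"
  have ind: "indep_vars (\<lambda>_. borel) \<xi> {\<tau>..}" and mean: "\<And>j. j \<ge> \<tau> \<Longrightarrow> expectation (\<xi> j) = 0"
    and sq: "\<And>j. j \<ge> \<tau> \<Longrightarrow> integrable M (\<lambda>\<omega>. (norm (\<xi> j \<omega>))\<^sup>2)"
    and var: "\<And>j. j \<ge> \<tau> \<Longrightarrow> expectation (\<lambda>\<omega>. (norm (\<xi> j \<omega>))\<^sup>2) \<le> \<sigma>\<^sup>2"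
    using noise by (auto simp: sdgd_noise_def)
  have G: "linear (\<lambda>x. delayed T \<tau> m (- \<eta> *\<^sub>R x))" for m
    using linear_compose[OF linear_compose_scale_right[OF linear_id, of "- \<eta>"] linear_delayed[OF T, of \<tau> m]]
    by (simp add: o_def)
  have meas: "\<xi> j \<in> borel_measurable M" if "j \<ge> \<tau>" for j
    using ind that by (auto simp: indep_vars_def)
  have int: "integrable M (\<xi> j)" if "j \<ge> \<tau>" for j
    using square_integrable_imp_integrable[of "\<lambda>\<omega>. norm (\<xi> j \<omega>)"] sq meas that
    by (auto simp: integrable_norm_iff)
  have measX: "X j \<in> borel_measurable M" if "j \<in> ?J" for j
    unfolding X_def using measurable_compose[OF meas linear_borel_measurable[OF G]] that by auto
  have XQ: "integrable M (\<lambda>\<omega>. X j \<omega> \<bullet> (A *v X j \<omega>))"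
    "expectation (\<lambda>\<omega>. X j \<omega> \<bullet> (A *v X j \<omega>)) \<le> C (k - 1 - j) * (\<eta>\<^sup>2 * \<sigma>\<^sup>2)" if j: "j \<in> ?J" for j
  proof -
    have "linear (\<lambda>x. delayed T \<tau> (k - 1 - j) (- \<eta> *\<^sub>R x))" by (rule G)
    then obtain K where K: "\<And>x. norm (delayed T \<tau> (k - 1 - j) (- \<eta> *\<^sub>R x)) \<le> K * norm x"
      using linear_bounded by blast
    obtain L where L: "\<And>u. \<bar>u \<bullet> (A *v u)\<bar> \<le> L * (norm u)\<^sup>2"
      using linear_quadratic_form_bounded[OF f] by blast
    have bound: "\<bar>X j \<omega> \<bullet> (A *v X j \<omega>)\<bar> \<le> \<bar>L\<bar> * K\<^sup>2 * (norm (\<xi> j \<omega>))\<^sup>2" for \<omega>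
    proof -
      have "\<bar>X j \<omega> \<bullet> (A *v X j \<omega>)\<bar> \<le> \<bar>L\<bar> * (norm (X j \<omega>))\<^sup>2"
        using L[of "X j \<omega>"] mult_right_mono[OF abs_ge_self, of "(norm (X j \<omega>))\<^sup>2" L] by simp
      also have "\<dots> \<le> \<bar>L\<bar> * (K * norm (\<xi> j \<omega>))\<^sup>2"
        unfolding X_def by (intro mult_left_mono power_mono K) auto
      finally show ?thesis by (simp add: power_mult_distrib)
    qed
    show int': "integrable M (\<lambda>\<omega>. X j \<omega> \<bullet> (A *v X j \<omega>))"
    proof (rule Bochner_Integration.integrable_bound)
      show "integrable M (\<lambda>\<omega>. \<bar>L\<bar> * K\<^sup>2 * (norm (\<xi> j \<omega>))\<^sup>2)" using sq[of j] j by simp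
      show "(\<lambda>\<omega>. X j \<omega> \<bullet> (A *v X j \<omega>)) \<in> borel_measurable M"
        using measX[OF j] measurable_compose[OF measX[OF j] linear_borel_measurable[OF f]] by simp
      show "AE \<omega> in M. norm (X j \<omega> \<bullet> (A *v X j \<omega>)) \<le> norm (\<bar>L\<bar> * K\<^sup>2 * (norm (\<xi> j \<omega>))\<^sup>2)"
        using order_trans[OF bound abs_ge_self] by simp
    qed
    have "expectation (\<lambda>\<omega>. X j \<omega> \<bullet> (A *v X j \<omega>)) \<le>
        expectation (\<lambda>\<omega>. C (k - 1 - j) * \<eta>\<^sup>2 * (norm (\<xi> j \<omega>))\<^sup>2)"
    proof (rule integral_mono[OF int'])
      show "integrable M (\<lambda>\<omega>. C (k - 1 - j) * \<eta>\<^sup>2 * (norm (\<xi> j \<omega>))\<^sup>2)" using sq[of j] j by simp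
      show "X j \<omega> \<bullet> (A *v X j \<omega>) \<le> C (k - 1 - j) * \<eta>\<^sup>2 * (norm (\<xi> j \<omega>))\<^sup>2" for \<omega>
        using form[of "k - 1 - j" "- \<eta> *\<^sub>R \<xi> j \<omega>"] by (simp add: X_def power_mult_distrib mult.assoc)
    qed
    also have "\<dots> = C (k - 1 - j) * \<eta>\<^sup>2 * expectation (\<lambda>\<omega>. (norm (\<xi> j \<omega>))\<^sup>2)" by simp
    also have "\<dots> \<le> C (k - 1 - j) * \<eta>\<^sup>2 * \<sigma>\<^sup>2"
      using var[of j] C(2) j by (intro mult_left_mono) auto
    finally show "expectation (\<lambda>\<omega>. X j \<omega> \<bullet> (A *v X j \<omega>)) \<le> C (k - 1 - j) * (\<eta>\<^sup>2 * \<sigma>\<^sup>2)"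
      by (simp add: mult.assoc)
  qed
  have "integrable M (\<lambda>\<omega>. ?Z \<omega> \<bullet> (A *v ?Z \<omega>)) \<and>
    expectation (\<lambda>\<omega>. ?Z \<omega> \<bullet> (A *v ?Z \<omega>)) =
      u \<bullet> (A *v u) + (\<Sum>j\<in>?J. expectation (\<lambda>\<omega>. X j \<omega> \<bullet> (A *v X j \<omega>)))"
  proof (rule quadratic_form_indep_sum[OF f sym _ _ _ _ XQ(1)])
    fix i j assume ij: "i \<in> ?J" "j \<in> ?J" "i \<noteq> j"
    have "indep_var borel (\<xi> i) borel (\<xi> j)"
      using indep_vars_imp_indep_var[OF ind, of i j] ij by simp
    from indep_var_compose[OF this linear_borel_measurable[OF G] linear_borel_measurable[OF G]]
    show "indep_var borel (X i) borel (X j)" unfolding X_def by (simp add: o_def)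
  next
    fix j assume j: "j \<in> ?J"
    have bG: "bounded_linear (\<lambda>x. delayed T \<tau> (k - 1 - j) (- \<eta> *\<^sub>R x))"
      using G linear_linear by blast
    show "integrable M (X j)" unfolding X_def
      using integrable_bounded_linear[OF bG int] j by simp
    have "expectation (X j) = delayed T \<tau> (k - 1 - j) (- \<eta> *\<^sub>R expectation (\<xi> j))" unfolding X_def
      using integral_bounded_linear[OF bG int] j by simp
    then show "expectation (X j) = 0"
      using mean[of j] j linear_0[OF linear_delayed[OF T]] by simp
  qed auto
  moreover have "u \<bullet> (A *v u) \<le> C k * (norm (w0 - w))\<^sup>2"
    unfolding u_def by (rule form)
  moreover have "(\<Sum>j\<in>?J. expectation (\<lambda>\<omega>. X j \<omega> \<bullet> (A *v X j \<omega>))) \<le> \<eta>\<^sup>2 * \<sigma>\<^sup>2 * (\<Sum>m<k. C m)"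
  proof -
    have "(\<Sum>j\<in>?J. expectation (\<lambda>\<omega>. X j \<omega> \<bullet> (A *v X j \<omega>))) \<le> (\<Sum>j\<in>?J. C (k - 1 - j) * (\<eta>\<^sup>2 * \<sigma>\<^sup>2))"
      by (intro sum_mono XQ(2))
    \<comment> \<open>Including the indices below \<open>\<tau>\<close>, where no noise enters, only
      enlarges the sum because \<open>C\<close> is nonnegative; reversal then lists all ages below
      \<open>k\<close>.\<close>
    also have "\<dots> \<le> (\<Sum>j<k. C (k - 1 - j) * (\<eta>\<^sup>2 * \<sigma>\<^sup>2))"
      using C(2) by (intro sum_mono2) auto
    also have "\<dots> = (\<Sum>m<k. C m * (\<eta>\<^sup>2 * \<sigma>\<^sup>2))"
      using sum.nat_diff_reindex[of "\<lambda>m. C m * (\<eta>\<^sup>2 * \<sigma>\<^sup>2)" k] by simp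
    finally show ?thesis by (subst mult.commute) (simp add: sum_distrib_right)
  qed
  \<comment> \<open>The gradient vanishes at \<open>w\<close>, so the excess is exactly half the
    quadratic form of the error.\<close>
  moreover have eq: "F (sdgd F \<tau> \<eta> w0 (\<lambda>j. \<xi> j \<omega>) k) - F w = 1/2 * (?Z \<omega> \<bullet> (A *v ?Z \<omega>))" for \<omega>
    using quadratic_add[OF A, of b c w "sdgd F \<tau> \<eta> w0 (\<lambda>j. \<xi> j \<omega>) k - w"]
      sdgd_quadratic_error[OF A w0, of c \<tau> \<eta> w0 "\<lambda>j. \<xi> j \<omega>" k, folded F]
    by (simp add: w0 F u_def X_def T_def)
  ultimately show ?thesis unfolding expectation_le_def eq by simp
qed

subsection \<open>Bounds for a fixed step size\<close>

text \<open>Squaring the scalar bound doubles the rate and turns 10/9 into 100/81. The step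
  condition at \<open>\<mu>\<close> passes down to every eigenvalue below it.\<close>

lemma delayed_eigenvalue_le:
  assumes \<eta>: "0 \<le> \<eta>" "\<eta> * \<mu> * real d \<le> 1 / 20" and d: "d > 0" and a: "0 \<le> a" "a \<le> \<mu>"
  shows "a * (delayed (\<lambda>y. \<eta> * a * y) d m 1)\<^sup>2 \<le> 100 / 81 * (a * exp (- (2 * \<eta> * (real m + 1) * a)))"
proof -
  let ?h = "delayed (\<lambda>y. \<eta> * a * y) d m 1"
  have "\<eta> * a * real d \<le> \<eta> * \<mu> * real d"
    using \<eta>(1) a by (intro mult_right_mono mult_left_mono) auto
  then have x: "0 \<le> \<eta> * a" "\<eta> * a * real d \<le> 1 / 20" using \<eta> a by auto
  note h = delayed_scalar_le[OF x d, of m]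
  have "?h\<^sup>2 \<le> (10 / 9 * exp (- (\<eta> * a) * (real m + 1)))\<^sup>2"
    using h by (intro power_mono) auto
  also have "\<dots> = 100 / 81 * exp (- (2 * \<eta> * (real m + 1) * a))"
    unfolding power_mult_distrib power_divide exp_double[symmetric] by (simp add: algebra_simps)
  finally show ?thesis using a mult_left_mono by fastforce
qed

section \<open>Harmonic sums, plain and exponentially damped\<close>

lemma sum_inverse_le: "(\<Sum>m<k. 1 / (real m + 1)) \<le> 1 + ln (real k + 1)"
proof -
  have "(\<Sum>m<k. 1 / (real m + 1)) = harm k"
    by (induction k) (auto simp: harm_Suc harm_expand field_simps)
  \<comment> \<open>The difference \<open>harm (Suc n) - ln (Suc n)\<close> decreases from its value
    1 at \<open>n = 0\<close>, whence the shift to \<open>Suc k\<close>.\<close>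
  also have "\<dots> \<le> harm (Suc k)" by (rule harm_mono) simp
  also have "\<dots> \<le> 1 + ln (real k + 1)"
    using decseqD[OF decseq_harm_diff_ln, of 0 k] by (simp add: harm_expand add.commute)
  finally show ?thesis .
qed

text \<open>The left side is a partial sum of the series of \<open>- ln (1 - q)\<close>, whose terms
  are nonnegative. In \<open>ln_series\<close> at \<open>1 - q\<close> the alternating sign cancels
  against the powers of \<open>- q\<close>.\<close>

lemma sum_power_div_le:
  fixes q :: real
  assumes q: "0 < q" "q < 1"
  shows "(\<Sum>m<k. q ^ Suc m / (real m + 1)) \<le> - ln (1 - q)"
proof -
  let ?t = "\<lambda>n. (- 1) ^ n * (1 / real (n + 1)) * ((1 - q) - 1) ^ Suc n"
  have t: "?t n = - (q ^ Suc n / (real n + 1))" for n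
  proof -
    have "(- 1) ^ n * (- q) ^ Suc n = - (q ^ Suc n)"
      by (induction n) auto
    then show ?thesis by (simp add: field_simps)
  qed
  have summ: "summable (\<lambda>n. q ^ Suc n / (real n + 1))"
  proof (rule summable_comparison_test')
    show "summable (\<lambda>n. q ^ n)" using q by (intro summable_geometric) auto
    fix n :: nat
    have "q ^ Suc n / (real n + 1) \<le> q ^ n / 1"
      using q by (intro frac_le) (auto simp: mult_left_le_one_le)
    then show "norm (q ^ Suc n / (real n + 1)) \<le> q ^ n" using q by simp
  qed
  have "ln (1 - q) = (\<Sum>n. ?t n)" using q by (intro ln_series) auto
  then have ln: "- ln (1 - q) = (\<Sum>n. q ^ Suc n / (real n + 1))"
    unfolding t using suminf_minus[OF summ] by simp
  show ?thesis unfolding ln using q by (intro sum_le_suminf summ) auto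
qed

text \<open>Damping replaces the logarithm of \<open>k\<close> in the harmonic sum by one of
  \<open>1 / x\<close>, uniformly in \<open>k\<close>.\<close>

lemma sum_exp_div_le:
  fixes x :: real
  assumes x: "0 < x" "x \<le> 1 / 20"
  shows "(\<Sum>m<k. exp (- (x / 2 * (real m + 1))) / (real m + 1)) \<le> 1 + ln (1 / x)"
proof -
  define y where "y = x / 2"
  have y: "0 < y" "y \<le> 1 / 40" using x by (auto simp: y_def)
  have "exp (- (y * (real m + 1))) = exp (- y) ^ Suc m" for m
    by (simp only: exp_of_nat_mult[symmetric]) (simp add: algebra_simps)
  then have "(\<Sum>m<k. exp (- (y * (real m + 1))) / (real m + 1)) =
      (\<Sum>m<k. exp (- y) ^ Suc m / (real m + 1))" by simp
  also have "\<dots> \<le> - ln (1 - exp (- y))" using y by (intro sum_power_div_le) auto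
  also have "\<dots> \<le> - ln (y * exp (- y))"
  proof -
    \<comment> \<open>This bounds \<open>1 - exp (- y)\<close> from below by
      \<open>y * exp (- y)\<close>, so that its logarithm splits into explicit terms.\<close>
    have "(1 + y) * exp (- y) \<le> exp y * exp (- y)" by (intro mult_right_mono) auto
    then have "y * exp (- y) \<le> 1 - exp (- y)" by (simp add: algebra_simps flip: exp_add)
    then show ?thesis using y by simp
  qed
  also have "\<dots> = y - ln x + ln 2"
    using y x by (simp add: ln_mult y_def ln_div)
  \<comment> \<open>The remainder \<open>y + ln 2\<close> is at most 1/40 + 25/36, below 1.\<close>
  also have "\<dots> \<le> 1 + ln (1 / x)"
    using y x ln2_le_25_over_36 by (simp add: ln_div)
  finally show ?thesis by (simp add: y_def)
qed

text \<open>The decay at rate \<open>2 * \<eta>\<close> is split for the noise: 3/2 of it is spent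
  on removing the factor \<open>a\<close>, and 1/2 is kept at \<open>lam\<close> to damp the
  harmonic sum. Spending 3/2 brings the constant to 100/81 * 2/3 = 200/243, below 1.\<close>

lemma sdgd_strongly_convex_le:
  assumes \<eta>: "0 < \<eta>" "\<eta> * \<mu> * real \<tau> \<le> 1 / 20" and \<tau>: "\<tau> > 0" and lam: "0 < lam" "lam \<le> \<mu>"
    and F: "strongly_convex_smooth_quadratic lam \<mu> F" "minimizer F wstar" and noise: "sdgd_noise M \<tau> \<sigma> \<xi>"
  shows "expectation_le M (\<lambda>\<omega>. F (sdgd F \<tau> \<eta> w0 (\<lambda>j. \<xi> j \<omega>) k) - F wstar)
    (\<mu> * exp (- 2 * \<eta> * lam * (real k + 1)) * (norm (w0 - wstar))\<^sup>2
      + \<eta> * \<sigma>\<^sup>2 / (2 * exp 1) * (1 + ln (1 / (\<eta> * lam))))"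
proof -
  obtain A b c where A: "positive_semidefinite A" "F = quadratic A b c"
    and eig: "\<And>a. eigenvalue A a \<Longrightarrow> lam \<le> a \<and> a \<le> \<mu>"
    using F(1) unfolding strongly_convex_smooth_quadratic_def by auto
  have tr: "transpose A = A" using A(1) by (simp add: positive_semidefinite_def)
  define B where "B = (\<lambda>m. 100 / 81 * (1 / (exp 1 * (3 / 2 * \<eta> * (real m + 1))) * exp (- (\<eta> * lam / 2 * (real m + 1)))))"
  \<comment> \<open>The value at \<open>k\<close> is charged only to the initial error and the
    values below \<open>k\<close> only to the noise, so the two may use different bounds; the
    initial error keeps the full rate at \<open>lam\<close>.\<close>
  define K where "K = (\<lambda>m. if m = k then 100 / 81 * (\<mu> * exp (- (2 * \<eta> * (real k + 1) * lam))) else B m)"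
  have "expectation_le M (\<lambda>\<omega>. F (sdgd F \<tau> \<eta> w0 (\<lambda>j. \<xi> j \<omega>) k) - F wstar)
    (1/2 * (K k * (norm (w0 - wstar))\<^sup>2 + \<eta>\<^sup>2 * \<sigma>\<^sup>2 * (\<Sum>m<k. K m)))"
  proof (rule sdgd_expectation_le[OF tr A(2) F(2) noise])
    show "0 \<le> K m" for m using \<eta> lam by (simp add: K_def B_def)
  next
    fix a m assume "eigenvalue A a"
    then have a: "0 \<le> a" "lam \<le> a" "a \<le> \<mu>" using eig lam by force+
    let ?n = "real m + 1"
    have le: "a * exp (- (2 * \<eta> * ?n * a)) \<le> \<mu> * exp (- (2 * \<eta> * ?n * lam))"
      using a \<eta> by (intro mult_mono) auto
    have s: "3 / 2 * \<eta> * ?n > 0" using \<eta> by simp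
    have split: "- (2 * \<eta> * ?n * a) = - (3 / 2 * \<eta> * ?n * a) + - (\<eta> * a / 2 * ?n)"
      by (simp add: field_simps)
    have "a * exp (- (2 * \<eta> * ?n * a)) =
        a * exp (- (3 / 2 * \<eta> * ?n * a)) * exp (- (\<eta> * a / 2 * ?n))"
      unfolding split exp_add by simp
    also have "\<dots> \<le> 1 / (exp 1 * (3 / 2 * \<eta> * ?n)) * exp (- (\<eta> * lam / 2 * ?n))"
      using a \<eta> by (intro mult_mono mult_exp_minus_le[OF s]) auto
    finally have "100 / 81 * (a * exp (- (2 * \<eta> * ?n * a))) \<le> B m"
      unfolding B_def by (rule mult_left_mono) simp
    then have "100 / 81 * (a * exp (- (2 * \<eta> * ?n * a))) \<le> K m"
      using le by (auto simp: K_def)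
    then show "a * (delayed (\<lambda>y. \<eta> * a * y) \<tau> m 1)\<^sup>2 \<le> K m"
      using delayed_eigenvalue_le[OF _ \<eta>(2) \<tau> a(1,3), of m] \<eta> by simp
  qed
  moreover have "1/2 * (K k * (norm (w0 - wstar))\<^sup>2 + \<eta>\<^sup>2 * \<sigma>\<^sup>2 * (\<Sum>m<k. K m)) \<le>
    \<mu> * exp (- 2 * \<eta> * lam * (real k + 1)) * (norm (w0 - wstar))\<^sup>2
      + \<eta> * \<sigma>\<^sup>2 / (2 * exp 1) * (1 + ln (1 / (\<eta> * lam)))"
  proof -
    have "\<eta> * lam * 1 \<le> \<eta> * \<mu> * real \<tau>"
      using \<eta> lam \<tau> by (intro mult_mono) auto
    then have x: "0 < \<eta> * lam" "\<eta> * lam \<le> 1 / 20"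
      using \<eta> lam by (simp, linarith)
    let ?S = "\<Sum>m<k. exp (- (\<eta> * lam / 2 * (real m + 1))) / (real m + 1)"
    have S: "0 \<le> ?S" "?S \<le> 1 + ln (1 / (\<eta> * lam))"
      using sum_exp_div_le[OF x, of k] by (auto intro!: sum_nonneg)
    have "(\<Sum>m<k. K m) = (\<Sum>m<k. B m)" by (intro sum.cong) (auto simp: K_def)
    also have "\<dots> = 200 / 243 / (exp 1 * \<eta>) * ?S"
      unfolding B_def sum_distrib_left by (intro sum.cong) simp_all
    finally have "1/2 * (\<eta>\<^sup>2 * \<sigma>\<^sup>2 * (\<Sum>m<k. K m)) = \<eta> * \<sigma>\<^sup>2 / (2 * exp 1) * (200 / 243 * ?S)"
      using \<eta> by (simp add: field_simps power2_eq_square)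
    also have "\<dots> \<le> \<eta> * \<sigma>\<^sup>2 / (2 * exp 1) * (1 + ln (1 / (\<eta> * lam)))"
      using S \<eta> by (intro mult_left_mono) auto
    finally have "1/2 * (\<eta>\<^sup>2 * \<sigma>\<^sup>2 * (\<Sum>m<k. K m)) \<le> \<eta> * \<sigma>\<^sup>2 / (2 * exp 1) * (1 + ln (1 / (\<eta> * lam)))" .
    moreover have "1/2 * (K k * (norm (w0 - wstar))\<^sup>2) \<le>
        \<mu> * exp (- 2 * \<eta> * lam * (real k + 1)) * (norm (w0 - wstar))\<^sup>2"
    proof -
      have "1/2 * K k = 50 / 81 * (\<mu> * exp (- 2 * \<eta> * lam * (real k + 1)))"
        by (simp add: K_def algebra_simps)
      also have "\<dots> \<le> \<mu> * exp (- 2 * \<eta> * lam * (real k + 1))" using lam by simp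
      finally have "1/2 * K k * (norm (w0 - wstar))\<^sup>2 \<le>
        \<mu> * exp (- 2 * \<eta> * lam * (real k + 1)) * (norm (w0 - wstar))\<^sup>2" by (rule mult_right_mono) simp
      then show ?thesis by simp
    qed
    ultimately show ?thesis unfolding distrib_left[of "1/2"] by linarith
  qed
  ultimately show ?thesis unfolding expectation_le_def by linarith
qed

text \<open>Eigenvalues may now be arbitrarily small, so the whole decay is spent on removing
  \<open>a\<close>, and the undamped harmonic sum gives the logarithm of \<open>k\<close>.\<close>

lemma sdgd_convex_le:
  assumes \<eta>: "0 < \<eta>" "\<eta> * \<mu> * real \<tau> \<le> 1 / 20" and \<tau>: "\<tau> > 0"
    and F: "smooth_convex_quadratic \<mu> F" "minimizer F wstar" and noise: "sdgd_noise M \<tau> \<sigma> \<xi>"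
  shows "expectation_le M (\<lambda>\<omega>. F (sdgd F \<tau> \<eta> w0 (\<lambda>j. \<xi> j \<omega>) k) - F wstar)
    ((norm (w0 - wstar))\<^sup>2 / (2 * exp 1 * \<eta> * (real k + 1))
      + \<eta> * \<sigma>\<^sup>2 / (2 * exp 1) * (1 + ln (real k + 1)))"
proof -
  obtain A b c where A: "positive_semidefinite A" "F = quadratic A b c"
    and eig: "\<And>a. eigenvalue A a \<Longrightarrow> 0 \<le> a \<and> a \<le> \<mu>"
    using F(1) unfolding smooth_convex_quadratic_def by auto
  have tr: "transpose A = A" using A(1) by (simp add: positive_semidefinite_def)
  define K where "K = (\<lambda>m. 100 / 81 * (1 / (exp 1 * (2 * \<eta> * (real m + 1)))))"
  have "expectation_le M (\<lambda>\<omega>. F (sdgd F \<tau> \<eta> w0 (\<lambda>j. \<xi> j \<omega>) k) - F wstar)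
    (1/2 * (K k * (norm (w0 - wstar))\<^sup>2 + \<eta>\<^sup>2 * \<sigma>\<^sup>2 * (\<Sum>m<k. K m)))"
  proof (rule sdgd_expectation_le[OF tr A(2) F(2) noise])
    show "0 \<le> K m" for m using \<eta> by (simp add: K_def)
  next
    fix a m assume "eigenvalue A a"
    then have a: "0 \<le> a" "a \<le> \<mu>" using eig by auto
    have "a * exp (- (2 * \<eta> * (real m + 1) * a)) \<le> 1 / (exp 1 * (2 * \<eta> * (real m + 1)))"
      using \<eta> by (intro mult_exp_minus_le) auto
    then show "a * (delayed (\<lambda>y. \<eta> * a * y) \<tau> m 1)\<^sup>2 \<le> K m"
      using delayed_eigenvalue_le[OF _ \<eta>(2) \<tau> a, of m] \<eta> unfolding K_def by linarith
  qed
  moreover have "1/2 * (K k * (norm (w0 - wstar))\<^sup>2 + \<eta>\<^sup>2 * \<sigma>\<^sup>2 * (\<Sum>m<k. K m)) \<le>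
    (norm (w0 - wstar))\<^sup>2 / (2 * exp 1 * \<eta> * (real k + 1))
      + \<eta> * \<sigma>\<^sup>2 / (2 * exp 1) * (1 + ln (real k + 1))"
  proof -
    let ?S = "\<Sum>m<k. 1 / (real m + 1)"
    have S: "0 \<le> ?S" "?S \<le> 1 + ln (real k + 1)" by (auto intro!: sum_nonneg sum_inverse_le)
    have "(\<Sum>m<k. K m) = 50 / 81 / (exp 1 * \<eta>) * ?S"
      unfolding K_def sum_distrib_left by (intro sum.cong) simp_all
    then have "1/2 * (\<eta>\<^sup>2 * \<sigma>\<^sup>2 * (\<Sum>m<k. K m)) = \<eta> * \<sigma>\<^sup>2 / (2 * exp 1) * (50 / 81 * ?S)"
      using \<eta> by (simp add: field_simps power2_eq_square)
    also have "\<dots> \<le> \<eta> * \<sigma>\<^sup>2 / (2 * exp 1) * (1 + ln (real k + 1))"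
      using S \<eta> by (intro mult_left_mono) auto
    finally have "1/2 * (\<eta>\<^sup>2 * \<sigma>\<^sup>2 * (\<Sum>m<k. K m)) \<le> \<eta> * \<sigma>\<^sup>2 / (2 * exp 1) * (1 + ln (real k + 1))" .
    moreover have "1/2 * (K k * (norm (w0 - wstar))\<^sup>2) =
        50 / 81 * ((norm (w0 - wstar))\<^sup>2 / (2 * exp 1 * \<eta> * (real k + 1)))"
      by (simp add: K_def)
    moreover have "0 \<le> (norm (w0 - wstar))\<^sup>2 / (2 * exp 1 * \<eta> * (real k + 1))" using \<eta> by simp
    ultimately show ?thesis unfolding distrib_left[of "1/2"] by linarith
  qed
  ultimately show ?thesis unfolding expectation_le_def by linarith
qed

subsection \<open>Tuning the step size\<close>

text \<open>The step is \<open>\<eta>0\<close> capped at \<open>L / (lam * real k)\<close>. At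
  \<open>\<eta>0\<close> the bias is the exponential term; at the cap it is at most
  \<open>exp (- 2 * L)\<close> times \<open>\<mu> * D\<^sup>2\<close>, which the variance term
  absorbs. The lower bound on \<open>\<eta>0\<close> keeps \<open>ln (1 / \<eta>0)\<close> within
  the logarithmic factor.\<close>

lemma tuned_step_strongly_convex:
  fixes \<mu> \<sigma> lam D \<eta>0 :: real and \<tau> k :: nat
  assumes \<mu>: "0 < \<mu>" and \<sigma>: "0 \<le> \<sigma>" and lam: "0 < lam" and D: "0 \<le> D" and \<tau>: "\<tau> > 0" and k: "k > 0"
    and \<eta>0: "1 / (40 * \<mu> * real \<tau>) \<le> \<eta>0"
  shows "\<exists>\<eta>\<in>{0<..\<eta>0}.
    \<mu> * exp (- 2 * \<eta> * lam * (real k + 1)) * D\<^sup>2 + \<eta> * \<sigma>\<^sup>2 / (2 * exp 1) * (1 + ln (1 / (\<eta> * lam)))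
    \<le> soft_O [\<mu>, lam, real \<tau>, real k, D, \<sigma>]
        (\<sigma>\<^sup>2 / (lam * real k) + \<mu> * D\<^sup>2 * exp (- 2 * \<eta>0 * lam * (real k + 1)))"
proof -
  define L where "L = 1 + (\<bar>ln \<mu>\<bar> + \<bar>ln lam\<bar> + \<bar>ln (real \<tau>)\<bar> + \<bar>ln (real k)\<bar> + \<bar>ln D\<bar> + \<bar>ln \<sigma>\<bar>)"
  obtain m l t n d s where abs: "m = \<bar>ln \<mu>\<bar>" "l = \<bar>ln lam\<bar>" "t = \<bar>ln (real \<tau>)\<bar>" "n = \<bar>ln (real k)\<bar>"
    "d = \<bar>ln D\<bar>" "s = \<bar>ln \<sigma>\<bar>" by blast
  have L_eq: "L = 1 + (m + l + t + n + d + s)" by (simp add: L_def abs)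
  have L_bounds: "ln \<mu> \<le> m" "ln lam \<le> l" "- ln lam \<le> l" "ln (real \<tau>) \<le> t" "ln (real k) \<le> n" "ln D \<le> d"
    "- ln \<sigma> \<le> s" "0 \<le> m" "0 \<le> l" "0 \<le> t" "0 \<le> n" "0 \<le> d" "0 \<le> s"
    unfolding abs by (rule abs_ge_self abs_ge_minus_self abs_ge_zero)+
  have L: "1 \<le> L" by (simp add: L_def)
  then have L2: "1 \<le> L\<^sup>2" by simp
  have pos: "0 < 1 / (40 * \<mu> * real \<tau>)" using \<mu> \<tau> by simp
  then have \<eta>0_pos: "0 < \<eta>0" using \<eta>0 by linarith
  define E where "E = \<mu> * D\<^sup>2 * exp (- 2 * \<eta>0 * lam * (real k + 1))"
  define V where "V = \<sigma>\<^sup>2 / (lam * real k)"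
  have EV: "0 \<le> E" "0 \<le> V" using \<mu> lam by (auto simp: E_def V_def)
  have soft: "soft_O [\<mu>, lam, real \<tau>, real k, D, \<sigma>] (V + E) = 100 * L\<^sup>2 * (V + E)"
    by (simp add: soft_O_def L_def add.assoc)
  show ?thesis
  \<comment> \<open>Without noise \<open>V\<close> is 0 and cannot absorb any bias, so the full step
    \<open>\<eta>0\<close> is taken.\<close>
  proof (cases "\<sigma> = 0")
    case True
    have "E \<le> 100 * L\<^sup>2 * E" using L2 EV by (intro mult_le_cancel_right1[THEN iffD2]) auto
    then show ?thesis
      using \<eta>0_pos True unfolding soft[unfolded E_def V_def]
      by (intro bexI[of _ \<eta>0]) (auto simp: E_def ac_simps)
  next
    case False
    then have \<sigma>: "0 < \<sigma>" using assms(2) by simp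
    define \<eta> where "\<eta> = min \<eta>0 (L / (lam * real k))"
    have \<eta>: "0 < \<eta>" "\<eta> \<le> \<eta>0" "\<eta> \<le> L / (lam * real k)"
      using \<eta>0_pos L lam k by (auto simp: \<eta>_def)
    have "exp (- 2 * \<eta> * lam * (real k + 1)) \<le> exp (- 2 * \<eta>0 * lam * (real k + 1)) + exp (- 2 * L)"
    proof (cases "\<eta> = \<eta>0")
      case False
      then have "\<eta> = L / (lam * real k)" by (simp add: \<eta>_def min_def split: if_splits)
      then have "2 * \<eta> * lam * (real k + 1) = 2 * L * ((real k + 1) / real k)"
        using lam by simp
      moreover have "2 * L * 1 \<le> 2 * L * ((real k + 1) / real k)"
        using L k by (intro mult_left_mono) auto
      ultimately have "exp (- 2 * \<eta> * lam * (real k + 1)) \<le> exp (- 2 * L)" by simp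
      then show ?thesis using exp_ge_zero[of "- 2 * \<eta>0 * lam * (real k + 1)"] by linarith
    qed simp
    then have "\<mu> * D\<^sup>2 * exp (- 2 * \<eta> * lam * (real k + 1)) \<le>
        \<mu> * D\<^sup>2 * (exp (- 2 * \<eta>0 * lam * (real k + 1)) + exp (- 2 * L))"
      using \<mu> by (intro mult_left_mono) auto
    moreover have "\<mu> * D\<^sup>2 * exp (- 2 * L) \<le> V"
    proof (cases "D = 0")
      case False
      then have D: "0 < D" using assms(4) by simp
      \<comment> \<open>Every logarithm occurring here has coefficient at most 2 and its absolute
        value is a summand of \<open>L\<close>; this is why \<open>2 * L\<close> suffices in the
        exponent.\<close>
      have "ln (\<mu> * D\<^sup>2 / V) = ln \<mu> + 2 * ln D - (2 * ln \<sigma> - (ln lam + ln (real k)))"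
        using \<mu> D \<sigma> lam k by (simp add: V_def ln_div ln_mult ln_realpow)
      also have "\<dots> \<le> 2 * L" using L_eq L_bounds by linarith
      finally have "exp (ln (\<mu> * D\<^sup>2 / V)) \<le> exp (2 * L)" by simp
      then have "\<mu> * D\<^sup>2 / V \<le> exp (2 * L)"
        using \<mu> D \<sigma> lam k by (simp add: V_def)
      then show ?thesis using \<sigma> lam k by (simp add: V_def exp_minus field_simps)
    qed (use EV in simp)
    ultimately have bias: "\<mu> * exp (- 2 * \<eta> * lam * (real k + 1)) * D\<^sup>2 \<le> E + V"
      unfolding E_def by (simp add: algebra_simps)
    have ln_le: "1 + ln (1 / (\<eta> * lam)) \<le> 40 * L"
    proof (cases "\<eta> = \<eta>0")
      case True
      \<comment> \<open>The factor 40 in \<open>40 * L\<close> comes from the leading 1 together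
        with the crude estimate \<open>ln 40 \<le> 39\<close>.\<close>
      have "ln (1 / (40 * \<mu> * real \<tau>)) \<le> ln \<eta>0" by (rule ln_mono) (use \<eta>0 pos in auto)
      then have "- ln \<eta>0 \<le> ln 40 + ln \<mu> + ln (real \<tau>)"
        using \<mu> \<tau> by (simp add: ln_div ln_mult)
      moreover have "ln (40::real) \<le> 39" using ln_le_minus_one[of "40::real"] by simp
      moreover have "ln (1 / (\<eta> * lam)) = - ln \<eta>0 - ln lam"
        using True \<eta> lam by (simp add: ln_div ln_mult)
      ultimately show ?thesis using L_eq L_bounds by linarith
    next
      case False
      then have "\<eta> = L / (lam * real k)" by (simp add: \<eta>_def min_def split: if_splits)
      then have "ln (1 / (\<eta> * lam)) = ln (real k) - ln L"
        using L lam k by (simp add: ln_div)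
      moreover have "0 \<le> ln L" using L by simp
      ultimately show ?thesis using L_eq L_bounds by linarith
    qed
    have "\<eta> * \<sigma>\<^sup>2 / (2 * exp 1) * (1 + ln (1 / (\<eta> * lam))) \<le> \<eta> * \<sigma>\<^sup>2 / (2 * exp 1) * (40 * L)"
      using \<eta> by (intro mult_left_mono ln_le) auto
    also have "\<dots> \<le> \<eta> * \<sigma>\<^sup>2 / 2 * (40 * L)"
      using \<eta> L by (intro mult_right_mono divide_left_mono) auto
    also have "\<dots> = 20 * L * \<sigma>\<^sup>2 * \<eta>" by simp
    also have "\<dots> \<le> 20 * L * \<sigma>\<^sup>2 * (L / (lam * real k))"
      using \<eta> L by (intro mult_left_mono) auto
    also have "\<dots> = 20 * L\<^sup>2 * V" by (simp add: V_def power2_eq_square)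
    finally have noise: "\<eta> * \<sigma>\<^sup>2 / (2 * exp 1) * (1 + ln (1 / (\<eta> * lam))) \<le> 20 * L\<^sup>2 * V" .
    \<comment> \<open>Altogether \<open>V\<close> is charged at most 21 times and \<open>E\<close>
      once, up to \<open>L\<^sup>2\<close>, well within the constant 100.\<close>
    have "E + V \<le> L\<^sup>2 * (E + V)" using L2 EV by (intro mult_le_cancel_right1[THEN iffD2]) auto
    then have "E + V + 20 * L\<^sup>2 * V \<le> 100 * L\<^sup>2 * (V + E)"
      using mult_nonneg_nonneg[OF zero_le_power2[of L] EV(1)] mult_nonneg_nonneg[OF zero_le_power2[of L] EV(2)]
      by (simp add: algebra_simps)
    then show ?thesis
      using bias noise \<eta> soft unfolding E_def V_def by (intro bexI[of _ \<eta>]) auto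
  qed
qed

text \<open>The step \<open>D / (\<sigma> * sqrt (real k))\<close> equates
  \<open>D\<^sup>2 / (\<eta> k)\<close> with \<open>\<eta> \<sigma>\<^sup>2\<close>, both being then
  \<open>V\<close>. If \<open>\<eta>0\<close> is smaller, the bias instead costs
  \<open>1 / \<eta>0\<close>, at most \<open>40 * \<mu> * real \<tau>\<close>, which is the term
  \<open>E\<close>.\<close>

lemma tuned_step_convex:
  fixes \<mu> \<sigma> D :: real and \<tau> k :: nat
  assumes \<mu>: "0 < \<mu>" and \<sigma>: "0 \<le> \<sigma>" and D: "0 \<le> D" "0 < D \<or> \<sigma> = 0" and \<tau>: "\<tau> > 0" and k: "k > 0"
    and \<eta>0: "1 / (40 * \<mu> * real \<tau>) \<le> \<eta>0"
  shows "\<exists>\<eta>\<in>{0<..\<eta>0}.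
    D\<^sup>2 / (2 * exp 1 * \<eta> * (real k + 1)) + \<eta> * \<sigma>\<^sup>2 / (2 * exp 1) * (1 + ln (real k + 1))
    \<le> soft_O [\<mu>, real \<tau>, real k, D, \<sigma>] (D * \<sigma> / sqrt (real k) + D\<^sup>2 * \<mu> * real \<tau> / real k)"
proof -
  define L where "L = 1 + (\<bar>ln \<mu>\<bar> + \<bar>ln (real \<tau>)\<bar> + \<bar>ln (real k)\<bar> + \<bar>ln D\<bar> + \<bar>ln \<sigma>\<bar>)"
  have L_ge: "1 + ln (real k) \<le> L" by (simp add: L_def)
  have L: "1 \<le> L" by (simp add: L_def)
  then have L2: "L \<le> L\<^sup>2" "1 \<le> L\<^sup>2" by (auto simp: self_le_power)
  have pos: "0 < 1 / (40 * \<mu> * real \<tau>)" using \<mu> \<tau> by simp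
  then have \<eta>0_pos: "0 < \<eta>0" using \<eta>0 by linarith
  have inv0: "1 / \<eta>0 \<le> 40 * \<mu> * real \<tau>"
    using \<eta>0 \<eta>0_pos \<mu> \<tau> by (simp add: field_simps)
  define E where "E = D\<^sup>2 * \<mu> * real \<tau> / real k"
  define V where "V = D * \<sigma> / sqrt (real k)"
  have EV: "0 \<le> E" "0 \<le> V" using \<mu> D \<sigma> by (auto simp: E_def V_def)
  have soft: "soft_O [\<mu>, real \<tau>, real k, D, \<sigma>] (V + E) = 100 * L\<^sup>2 * (V + E)"
    by (simp add: soft_O_def L_def add.assoc)
  \<comment> \<open>For \<open>\<sigma> = 0\<close> the quotient would be 0 by the convention on
    division, hence the separate case; otherwise \<open>D\<close> is positive and so is the
    step.\<close>
  define \<eta> where "\<eta> = (if \<sigma> = 0 then \<eta>0 else min \<eta>0 (D / (\<sigma> * sqrt (real k))))"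
  have \<eta>: "0 < \<eta>" "\<eta> \<le> \<eta>0" using \<eta>0_pos \<sigma> D k by (auto simp: \<eta>_def)
  \<comment> \<open>The sum covers both branches of the minimum; multiplied by
    \<open>D / real k\<close> it becomes \<open>40 * E + V\<close>.\<close>
  have inv: "D * (1 / \<eta>) \<le> 40 * \<mu> * real \<tau> * D + \<sigma> * sqrt (real k)"
  proof (cases "\<eta> = \<eta>0")
    case True
    have "0 \<le> \<sigma> * sqrt (real k)" using \<sigma> by simp
    then show ?thesis using mult_left_mono[OF inv0 D(1)] True by (simp add: algebra_simps)
  next
    case False
    then have "\<eta> = D / (\<sigma> * sqrt (real k))" "\<sigma> \<noteq> 0" by (auto simp: \<eta>_def min_def split: if_splits)
    then have "D * (1 / \<eta>) = \<sigma> * sqrt (real k)" using D by auto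
    then show ?thesis using \<mu> D by simp
  qed
  have "\<eta> * real k * 1 \<le> \<eta> * (real k + 1) * (2 * exp 1)"
    using \<eta> exp_ge_add_one_self[of "1::real"] by (intro mult_mono) auto
  then have "D\<^sup>2 / (2 * exp 1 * \<eta> * (real k + 1)) \<le> D\<^sup>2 / (\<eta> * real k)"
    using \<eta> k by (intro divide_left_mono) (auto simp: ac_simps)
  also have "\<dots> = D * (1 / \<eta>) * (D / real k)" by (simp add: power2_eq_square)
  also have "\<dots> \<le> (40 * \<mu> * real \<tau> * D + \<sigma> * sqrt (real k)) * (D / real k)"
    using D by (intro mult_right_mono inv) auto
  also have "\<dots> = 40 * E + V"
    using k by (simp add: E_def V_def field_simps power2_eq_square)
  finally have bias: "D\<^sup>2 / (2 * exp 1 * \<eta> * (real k + 1)) \<le> 40 * E + V" .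
  have "ln (real k + 1) \<le> ln (2 * real k)" using k by simp
  also have "\<dots> \<le> 1 + ln (real k)" using k ln_2_less_1 by (simp add: ln_mult)
  finally have ln_le: "1 + ln (real k + 1) \<le> 2 * L" using L L_ge by linarith
  have \<eta>V: "\<eta> * \<sigma>\<^sup>2 \<le> V"
  proof (cases "\<sigma> = 0")
    case False
    then have "\<eta> * \<sigma>\<^sup>2 \<le> D / (\<sigma> * sqrt (real k)) * \<sigma>\<^sup>2" by (intro mult_right_mono) (auto simp: \<eta>_def)
    then show ?thesis using False by (simp add: V_def power2_eq_square)
  qed (use EV in simp)
  have "\<eta> * \<sigma>\<^sup>2 / (2 * exp 1) * (1 + ln (real k + 1)) \<le> \<eta> * \<sigma>\<^sup>2 / (2 * exp 1) * (2 * L)"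
    using \<eta> by (intro mult_left_mono ln_le) auto
  also have "\<dots> \<le> \<eta> * \<sigma>\<^sup>2 / 2 * (2 * L)"
    using \<eta> L by (intro mult_right_mono divide_left_mono) auto
  also have "\<dots> = L * (\<eta> * \<sigma>\<^sup>2)" by simp
  also have "\<dots> \<le> L\<^sup>2 * V" using L L2 \<eta>V \<eta> by (intro mult_mono) auto
  finally have noise: "\<eta> * \<sigma>\<^sup>2 / (2 * exp 1) * (1 + ln (real k + 1)) \<le> L\<^sup>2 * V" .
  have "1 * E \<le> L\<^sup>2 * E" "1 * V \<le> L\<^sup>2 * V" using L2 EV by (intro mult_right_mono; simp)+
  then have "40 * E + V + L\<^sup>2 * V \<le> 100 * L\<^sup>2 * (V + E)"
    using EV by (simp add: algebra_simps)
  then show ?thesis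
    using bias noise \<eta> soft unfolding E_def V_def by (intro bexI[of _ \<eta>]) auto
qed

section \<open>Assembly of the stated bounds\<close>

lemma expectation_le_mono: "expectation_le M X B \<Longrightarrow> B \<le> B' \<Longrightarrow> expectation_le M X B'"
  by (auto simp: expectation_le_def)

lemma soft_O_mono: "B \<le> B' \<Longrightarrow> soft_O ps B \<le> soft_O ps B'"
  unfolding soft_O_def by (intro mult_left_mono) auto

text \<open>Each tuned step is chosen before the measure, objective, initial point and noise,
  knowing only the distance \<open>D\<close>. The exponent with \<open>\<tau>\<close> is reached
  with steps up to \<open>1 / (20 * \<mu> * real \<tau>)\<close>, slightly beyond the range of the
  fixed-step bound; a second version stays in that range and has \<open>\<tau> + 1\<close> in the
  exponent. In the convex case \<open>D = 0\<close> with positive \<open>\<sigma>\<close> would make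
  the tuned bound 0 in spite of the noise.\<close>

theorem theorem4:
  fixes \<mu> \<sigma> :: real and \<tau> k :: nat
  assumes "\<mu> > 0" and "\<sigma> \<ge> 0" and "\<tau> > 0"
    and "real k \<ge> (real \<tau> + 1) * ln (2 * (real \<tau> + 1))"
  shows
    "(\<forall>lam. 0 < lam \<and> lam \<le> \<mu> \<longrightarrow>
        (\<forall>\<eta>\<in>{0<..1 / (20 * \<mu> * (real \<tau> + 1))}.
          \<forall>(M :: 'a measure) (F :: real^'n \<Rightarrow> real) w0 wstar \<xi>.
            strongly_convex_smooth_quadratic lam \<mu> F \<and> bdd_below (range F) \<and> minimizer F wstar \<and>
            sdgd_noise M \<tau> \<sigma> \<xi> \<longrightarrow>
            expectation_le M (\<lambda>\<omega>. F (sdgd F \<tau> \<eta> w0 (\<lambda>j. \<xi> j \<omega>) k) - F wstar)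
              (5 * \<mu> * exp (- 2 * \<eta> * lam * (real k + 1)) * (norm (w0 - wstar))\<^sup>2
               + \<eta>\<^sup>2 * \<sigma>\<^sup>2 / 2 *
                   (\<mu> * (real \<tau> + 1) * ln (2 * (real \<tau> + 1))
                    + (1 + exp 1 + ln (1 / (\<eta> * lam))) / (exp 1 * \<eta>)))) \<and>
        (\<forall>D. \<exists>\<eta>\<in>{0<..1 / (20 * \<mu> * real \<tau>)}.
          \<forall>(M :: 'a measure) (F :: real^'n \<Rightarrow> real) w0 wstar \<xi>.
            strongly_convex_smooth_quadratic lam \<mu> F \<and> bdd_below (range F) \<and> minimizer F wstar \<and>
            sdgd_noise M \<tau> \<sigma> \<xi> \<and> norm (w0 - wstar) = D \<longrightarrow>
            expectation_le M (\<lambda>\<omega>. F (sdgd F \<tau> \<eta> w0 (\<lambda>j. \<xi> j \<omega>) k) - F wstar)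
              (soft_O [\<mu>, lam, real \<tau>, real k, D, \<sigma>]
                (\<sigma>\<^sup>2 / (lam * real k)
                 + \<mu> * D\<^sup>2 * exp (- (lam * real k) / (10 * \<mu> * real \<tau>))))) \<and>
        (\<forall>D. \<exists>\<eta>\<in>{0<..1 / (20 * \<mu> * (real \<tau> + 1))}.
          \<forall>(M :: 'a measure) (F :: real^'n \<Rightarrow> real) w0 wstar \<xi>.
            strongly_convex_smooth_quadratic lam \<mu> F \<and> bdd_below (range F) \<and> minimizer F wstar \<and>
            sdgd_noise M \<tau> \<sigma> \<xi> \<and> norm (w0 - wstar) = D \<longrightarrow>
            expectation_le M (\<lambda>\<omega>. F (sdgd F \<tau> \<eta> w0 (\<lambda>j. \<xi> j \<omega>) k) - F wstar)
              (soft_O [\<mu>, lam, real \<tau>, real k, D, \<sigma>]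
                (\<sigma>\<^sup>2 / (lam * real k)
                 + \<mu> * D\<^sup>2 * exp (- (lam * (real k + 1)) / (10 * \<mu> * (real \<tau> + 1))))))) \<and>
     (\<forall>\<eta>\<in>{0<..1 / (20 * \<mu> * (real \<tau> + 1))}.
       \<forall>(M :: 'a measure) (F :: real^'n \<Rightarrow> real) w0 wstar \<xi>.
         smooth_convex_quadratic \<mu> F \<and> bdd_below (range F) \<and> minimizer F wstar \<and>
         sdgd_noise M \<tau> \<sigma> \<xi> \<longrightarrow>
         expectation_le M (\<lambda>\<omega>. F (sdgd F \<tau> \<eta> w0 (\<lambda>j. \<xi> j \<omega>) k) - F wstar)
           (9 * (norm (w0 - wstar))\<^sup>2 / (4 * exp 1 * \<eta> * (real k + 1))
            + \<eta>\<^sup>2 * \<sigma>\<^sup>2 *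
                (\<mu> * (real \<tau> + 1) * ln (2 * (real \<tau> + 1))
                 + 9 / (2 * exp 1 * \<eta>) * (1 + ln (real k + 1))))) \<and>
     (\<forall>D. 0 < D \<or> \<sigma> = 0 \<longrightarrow>
       (\<exists>\<eta>\<in>{0<..1 / (20 * \<mu> * (real \<tau> + 1))}.
         \<forall>(M :: 'a measure) (F :: real^'n \<Rightarrow> real) w0 wstar \<xi>.
           smooth_convex_quadratic \<mu> F \<and> bdd_below (range F) \<and> minimizer F wstar \<and>
           sdgd_noise M \<tau> \<sigma> \<xi> \<and> norm (w0 - wstar) = D \<longrightarrow>
           expectation_le M (\<lambda>\<omega>. F (sdgd F \<tau> \<eta> w0 (\<lambda>j. \<xi> j \<omega>) k) - F wstar)
             (soft_O [\<mu>, real \<tau>, real k, D, \<sigma>]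
               (D * \<sigma> / sqrt (real k) + D\<^sup>2 * \<mu> * real \<tau> / real k))))"
proof -
  note \<mu> = assms(1) and \<sigma> = assms(2) and \<tau> = assms(3)
  have ln_pos: "0 < ln (2 * (real \<tau> + 1))" using \<tau> by simp
  have "0 < (real \<tau> + 1) * ln (2 * (real \<tau> + 1))" using ln_pos by simp
  then have "0 < real k" using assms(4) by linarith
  then have k: "k > 0" by simp
  \<comment> \<open>Since \<open>\<tau> \<ge> 1\<close>, \<open>\<tau> + 1\<close> is at most
    \<open>2 * \<tau>\<close>; the tuning lemmas therefore apply to both caps on the step.\<close>
  have half: "1 / (40 * \<mu> * real \<tau>) \<le> 1 / (20 * \<mu> * (real \<tau> + 1))"
    using \<mu> \<tau> by (intro divide_left_mono) auto
  have small: "1 / (20 * \<mu> * (real \<tau> + 1)) \<le> 1 / (20 * \<mu> * real \<tau>)"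
    using \<mu> \<tau> by (intro divide_left_mono) auto
  have step: "0 < \<eta> \<and> \<eta> * \<mu> * real \<tau> \<le> 1 / 20" if "\<eta> \<in> {0<..1 / (20 * \<mu> * real \<tau>)}" for \<eta>
    using that \<mu> \<tau> by (simp add: pos_le_divide_eq ac_simps)
  have extra: "0 \<le> \<mu> * (real \<tau> + 1) * ln (2 * (real \<tau> + 1))" using \<mu> ln_pos by simp
  \<comment> \<open>Serves both tuned strongly convex claims: \<open>\<eta>0\<close> is the cap, and
    \<open>r\<close> is the exponent wanted in the statement.\<close>
  have sc: "\<exists>\<eta>\<in>{0<..\<eta>0}.
      \<forall>(M :: 'a measure) (F :: real^'n \<Rightarrow> real) w0 wstar \<xi>.
        strongly_convex_smooth_quadratic lam \<mu> F \<and> bdd_below (range F) \<and> minimizer F wstar \<and>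
        sdgd_noise M \<tau> \<sigma> \<xi> \<and> norm (w0 - wstar) = D \<longrightarrow>
        expectation_le M (\<lambda>\<omega>. F (sdgd F \<tau> \<eta> w0 (\<lambda>j. \<xi> j \<omega>) k) - F wstar)
          (soft_O [\<mu>, lam, real \<tau>, real k, D, \<sigma>] (\<sigma>\<^sup>2 / (lam * real k) + \<mu> * D\<^sup>2 * exp r))"
    if lam: "0 < lam" "lam \<le> \<mu>" and \<eta>0: "1 / (40 * \<mu> * real \<tau>) \<le> \<eta>0" "\<eta>0 \<le> 1 / (20 * \<mu> * real \<tau>)"
      and r: "- 2 * \<eta>0 * lam * (real k + 1) \<le> r" for lam \<eta>0 D r
  proof (cases "0 \<le> D")
    case True
    obtain \<eta> where \<eta>: "\<eta> \<in> {0<..\<eta>0}" and le: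
      "\<mu> * exp (- 2 * \<eta> * lam * (real k + 1)) * D\<^sup>2 + \<eta> * \<sigma>\<^sup>2 / (2 * exp 1) * (1 + ln (1 / (\<eta> * lam)))
        \<le> soft_O [\<mu>, lam, real \<tau>, real k, D, \<sigma>]
            (\<sigma>\<^sup>2 / (lam * real k) + \<mu> * D\<^sup>2 * exp (- 2 * \<eta>0 * lam * (real k + 1)))"
      using tuned_step_strongly_convex[OF \<mu> \<sigma> lam(1) True \<tau> k \<eta>0(1)] by blast
    have "\<mu> * D\<^sup>2 * exp (- 2 * \<eta>0 * lam * (real k + 1)) \<le> \<mu> * D\<^sup>2 * exp r"
      using \<mu> r by (intro mult_left_mono) auto
    then have le': "\<mu> * exp (- 2 * \<eta> * lam * (real k + 1)) * D\<^sup>2 + \<eta> * \<sigma>\<^sup>2 / (2 * exp 1) * (1 + ln (1 / (\<eta> * lam)))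
        \<le> soft_O [\<mu>, lam, real \<tau>, real k, D, \<sigma>] (\<sigma>\<^sup>2 / (lam * real k) + \<mu> * D\<^sup>2 * exp r)"
      by (intro order_trans[OF le] soft_O_mono) simp
    have "\<eta> \<in> {0<..1 / (20 * \<mu> * real \<tau>)}" using \<eta> \<eta>0 by auto
    with step have s: "0 < \<eta>" "\<eta> * \<mu> * real \<tau> \<le> 1 / 20" by auto
    show ?thesis
    proof (intro bexI[OF _ \<eta>] allI impI, elim conjE)
      fix M :: "'a measure" and F :: "real^'n \<Rightarrow> real" and w0 wstar :: "real^'n"
        and \<xi> :: "nat \<Rightarrow> 'a \<Rightarrow> real^'n"
      assume "strongly_convex_smooth_quadratic lam \<mu> F" "minimizer F wstar" "sdgd_noise M \<tau> \<sigma> \<xi>"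
        and D: "norm (w0 - wstar) = D"
      from sdgd_strongly_convex_le[OF s \<tau> lam this(1-3), of w0 k]
      show "expectation_le M (\<lambda>\<omega>. F (sdgd F \<tau> \<eta> w0 (\<lambda>j. \<xi> j \<omega>) k) - F wstar)
          (soft_O [\<mu>, lam, real \<tau>, real k, D, \<sigma>] (\<sigma>\<^sup>2 / (lam * real k) + \<mu> * D\<^sup>2 * exp r))"
        unfolding D using le' by (rule expectation_le_mono)
    qed
  next
    \<comment> \<open>No norm equals a negative \<open>D\<close>, so any step in the range is a
      witness.\<close>
    case False
    have "0 < 1 / (40 * \<mu> * real \<tau>)" using \<mu> \<tau> by simp
    then have "0 < \<eta>0" using \<eta>0 by linarith
    then have "\<eta>0 \<in> {0<..\<eta>0}" by simp
    moreover have "norm (w0 - wstar) \<noteq> D" for w0 wstar :: "real^'n" using False by auto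
    ultimately show ?thesis by blast
  qed
  show ?thesis
  proof (intro conjI allI impI ballI, elim conjE; (elim conjE)?)
    fix lam \<eta> and M :: "'a measure" and F :: "real^'n \<Rightarrow> real" and w0 wstar :: "real^'n"
        and \<xi> :: "nat \<Rightarrow> 'a \<Rightarrow> real^'n"
    assume lam: "0 < lam" "lam \<le> \<mu>" and \<eta>: "\<eta> \<in> {0<..1 / (20 * \<mu> * (real \<tau> + 1))}"
      and F: "strongly_convex_smooth_quadratic lam \<mu> F" "minimizer F wstar" "sdgd_noise M \<tau> \<sigma> \<xi>"
    have s: "0 < \<eta>" "\<eta> * \<mu> * real \<tau> \<le> 1 / 20" using step[of \<eta>] \<eta> small by auto
    let ?N = "(norm (w0 - wstar))\<^sup>2" and ?X = "\<mu> * (real \<tau> + 1) * ln (2 * (real \<tau> + 1))"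
      and ?Y = "ln (1 / (\<eta> * lam))"
    have "\<mu> * exp (- 2 * \<eta> * lam * (real k + 1)) * ?N \<le> 5 * \<mu> * exp (- 2 * \<eta> * lam * (real k + 1)) * ?N"
      using \<mu> by (intro mult_right_mono) auto
    moreover have "\<eta> * \<sigma>\<^sup>2 / (2 * exp 1) * (1 + ?Y) \<le> \<eta>\<^sup>2 * \<sigma>\<^sup>2 / 2 * (?X + (1 + exp 1 + ?Y) / (exp 1 * \<eta>))"
    proof -
      \<comment> \<open>The zeros mark the places where the stated bound has the nonnegative terms
        \<open>?X\<close> and \<open>exp 1\<close>.\<close>
      have "\<eta> * \<sigma>\<^sup>2 / (2 * exp 1) * (1 + ?Y) = \<eta>\<^sup>2 * \<sigma>\<^sup>2 / 2 * (0 + (1 + 0 + ?Y) / (exp 1 * \<eta>))"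
        using s by (simp add: power2_eq_square)
      also have "\<dots> \<le> \<eta>\<^sup>2 * \<sigma>\<^sup>2 / 2 * (?X + (1 + exp 1 + ?Y) / (exp 1 * \<eta>))"
        using s extra by (intro mult_left_mono add_mono divide_right_mono) auto
      finally show ?thesis .
    qed
    ultimately show "expectation_le M (\<lambda>\<omega>. F (sdgd F \<tau> \<eta> w0 (\<lambda>j. \<xi> j \<omega>) k) - F wstar)
        (5 * \<mu> * exp (- 2 * \<eta> * lam * (real k + 1)) * ?N
          + \<eta>\<^sup>2 * \<sigma>\<^sup>2 / 2 * (?X + (1 + exp 1 + ?Y) / (exp 1 * \<eta>)))"
      by (intro expectation_le_mono[OF sdgd_strongly_convex_le[OF s \<tau> lam F]] add_mono)
  next
    fix lam D :: real
    assume lam: "0 < lam" "lam \<le> \<mu>"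
    \<comment> \<open>The cap gives the exponent with \<open>k + 1\<close>; the stated one, with
      \<open>k\<close>, is weaker.\<close>
    have "- 2 * (1 / (20 * \<mu> * real \<tau>)) * lam * (real k + 1) \<le> - (lam * real k) / (10 * \<mu> * real \<tau>)"
      using \<mu> \<tau> lam by (simp add: field_simps)
    from sc[OF lam order_trans[OF half small] order_refl this]
    show "\<exists>\<eta>\<in>{0<..1 / (20 * \<mu> * real \<tau>)}.
      \<forall>(M :: 'a measure) (F :: real^'n \<Rightarrow> real) w0 wstar \<xi>.
        strongly_convex_smooth_quadratic lam \<mu> F \<and> bdd_below (range F) \<and> minimizer F wstar \<and>
        sdgd_noise M \<tau> \<sigma> \<xi> \<and> norm (w0 - wstar) = D \<longrightarrow>
        expectation_le M (\<lambda>\<omega>. F (sdgd F \<tau> \<eta> w0 (\<lambda>j. \<xi> j \<omega>) k) - F wstar)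
          (soft_O [\<mu>, lam, real \<tau>, real k, D, \<sigma>]
            (\<sigma>\<^sup>2 / (lam * real k) + \<mu> * D\<^sup>2 * exp (- (lam * real k) / (10 * \<mu> * real \<tau>))))" .
  next
    fix lam D :: real
    assume lam: "0 < lam" "lam \<le> \<mu>"
    have "- 2 * (1 / (20 * \<mu> * (real \<tau> + 1))) * lam * (real k + 1) \<le>
        - (lam * (real k + 1)) / (10 * \<mu> * (real \<tau> + 1))"
      using \<mu> by simp
    from sc[OF lam half small this]
    show "\<exists>\<eta>\<in>{0<..1 / (20 * \<mu> * (real \<tau> + 1))}.
      \<forall>(M :: 'a measure) (F :: real^'n \<Rightarrow> real) w0 wstar \<xi>.
        strongly_convex_smooth_quadratic lam \<mu> F \<and> bdd_below (range F) \<and> minimizer F wstar \<and>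
        sdgd_noise M \<tau> \<sigma> \<xi> \<and> norm (w0 - wstar) = D \<longrightarrow>
        expectation_le M (\<lambda>\<omega>. F (sdgd F \<tau> \<eta> w0 (\<lambda>j. \<xi> j \<omega>) k) - F wstar)
          (soft_O [\<mu>, lam, real \<tau>, real k, D, \<sigma>]
            (\<sigma>\<^sup>2 / (lam * real k)
              + \<mu> * D\<^sup>2 * exp (- (lam * (real k + 1)) / (10 * \<mu> * (real \<tau> + 1)))))" .
  next
    fix \<eta> and M :: "'a measure" and F :: "real^'n \<Rightarrow> real" and w0 wstar :: "real^'n"
        and \<xi> :: "nat \<Rightarrow> 'a \<Rightarrow> real^'n"
    assume \<eta>: "\<eta> \<in> {0<..1 / (20 * \<mu> * (real \<tau> + 1))}"
      and F: "smooth_convex_quadratic \<mu> F" "minimizer F wstar" "sdgd_noise M \<tau> \<sigma> \<xi>"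
    have s: "0 < \<eta>" "\<eta> * \<mu> * real \<tau> \<le> 1 / 20" using step[of \<eta>] \<eta> small by auto
    let ?N = "(norm (w0 - wstar))\<^sup>2" and ?X = "\<mu> * (real \<tau> + 1) * ln (2 * (real \<tau> + 1))"
    have "?N / (2 * exp 1 * \<eta> * (real k + 1)) = 2 / 9 * (9 * ?N / (4 * exp 1 * \<eta> * (real k + 1)))" by simp
    also have "\<dots> \<le> 1 * (9 * ?N / (4 * exp 1 * \<eta> * (real k + 1)))"
      using s by (intro mult_right_mono) auto
    finally have "?N / (2 * exp 1 * \<eta> * (real k + 1)) \<le> 9 * ?N / (4 * exp 1 * \<eta> * (real k + 1))" by simp
    moreover have "\<eta> * \<sigma>\<^sup>2 / (2 * exp 1) * (1 + ln (real k + 1)) \<le>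
        \<eta>\<^sup>2 * \<sigma>\<^sup>2 * (?X + 9 / (2 * exp 1 * \<eta>) * (1 + ln (real k + 1)))"
    proof -
      have "\<eta> * \<sigma>\<^sup>2 / (2 * exp 1) * (1 + ln (real k + 1)) =
          \<eta>\<^sup>2 * \<sigma>\<^sup>2 * (0 + 1 / (2 * exp 1 * \<eta>) * (1 + ln (real k + 1)))"
        using s by (simp add: power2_eq_square)
      also have "\<dots> \<le> \<eta>\<^sup>2 * \<sigma>\<^sup>2 * (?X + 9 / (2 * exp 1 * \<eta>) * (1 + ln (real k + 1)))"
        using s extra by (intro mult_left_mono add_mono mult_right_mono divide_right_mono) auto
      finally show ?thesis .
    qed
    ultimately show "expectation_le M (\<lambda>\<omega>. F (sdgd F \<tau> \<eta> w0 (\<lambda>j. \<xi> j \<omega>) k) - F wstar)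
        (9 * ?N / (4 * exp 1 * \<eta> * (real k + 1))
          + \<eta>\<^sup>2 * \<sigma>\<^sup>2 * (?X + 9 / (2 * exp 1 * \<eta>) * (1 + ln (real k + 1))))"
      by (intro expectation_le_mono[OF sdgd_convex_le[OF s \<tau> F]] add_mono)
  next
    fix D :: real
    assume D: "0 < D \<or> \<sigma> = 0"
    show "\<exists>\<eta>\<in>{0<..1 / (20 * \<mu> * (real \<tau> + 1))}.
      \<forall>(M :: 'a measure) (F :: real^'n \<Rightarrow> real) w0 wstar \<xi>.
        smooth_convex_quadratic \<mu> F \<and> bdd_below (range F) \<and> minimizer F wstar \<and>
        sdgd_noise M \<tau> \<sigma> \<xi> \<and> norm (w0 - wstar) = D \<longrightarrow>
        expectation_le M (\<lambda>\<omega>. F (sdgd F \<tau> \<eta> w0 (\<lambda>j. \<xi> j \<omega>) k) - F wstar)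
          (soft_O [\<mu>, real \<tau>, real k, D, \<sigma>]
            (D * \<sigma> / sqrt (real k) + D\<^sup>2 * \<mu> * real \<tau> / real k))"
    proof (cases "0 \<le> D")
      case True
      obtain \<eta> where \<eta>: "\<eta> \<in> {0<..1 / (20 * \<mu> * (real \<tau> + 1))}" and le:
        "D\<^sup>2 / (2 * exp 1 * \<eta> * (real k + 1)) + \<eta> * \<sigma>\<^sup>2 / (2 * exp 1) * (1 + ln (real k + 1))
          \<le> soft_O [\<mu>, real \<tau>, real k, D, \<sigma>] (D * \<sigma> / sqrt (real k) + D\<^sup>2 * \<mu> * real \<tau> / real k)"
        using tuned_step_convex[OF \<mu> \<sigma> True D \<tau> k half] by blast
      have s: "0 < \<eta>" "\<eta> * \<mu> * real \<tau> \<le> 1 / 20" using step[of \<eta>] \<eta> small by auto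
      show ?thesis
      proof (intro bexI[OF _ \<eta>] allI impI, elim conjE)
        fix M :: "'a measure" and F :: "real^'n \<Rightarrow> real" and w0 wstar :: "real^'n"
        and \<xi> :: "nat \<Rightarrow> 'a \<Rightarrow> real^'n"
        assume "smooth_convex_quadratic \<mu> F" "minimizer F wstar" "sdgd_noise M \<tau> \<sigma> \<xi>"
          and D: "norm (w0 - wstar) = D"
        from sdgd_convex_le[OF s \<tau> this(1-3), of w0 k]
        show "expectation_le M (\<lambda>\<omega>. F (sdgd F \<tau> \<eta> w0 (\<lambda>j. \<xi> j \<omega>) k) - F wstar)
            (soft_O [\<mu>, real \<tau>, real k, D, \<sigma>] (D * \<sigma> / sqrt (real k) + D\<^sup>2 * \<mu> * real \<tau> / real k))"
          unfolding D using le by (rule expectation_le_mono)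
      qed
    next
      case False
      then have "norm (w0 - wstar) \<noteq> D" for w0 wstar :: "real^'n" by auto
      moreover have "1 / (20 * \<mu> * (real \<tau> + 1)) \<in> {0<..1 / (20 * \<mu> * (real \<tau> + 1))}" using \<mu> by simp
      ultimately show ?thesis by blast
    qed
  qed
qed

end
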